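(* For every $\Delta\in\mathbb{N}$ there exists $C_\Delta$ such that for every tree $T$ of maximum degree at most $\Delta$ on $n$ vertices, $\hat{r}_{\text{ind}}(T)<C_\Delta\cdot n$. Moreover one can take $C_\Delta=10^{25}\Delta^3\log(\Delta)$.
   Context: For a graph $H$, the induced size Ramsey number $\hat{r}_{\text{ind}}(H)$ is the minimum number of edges $e(G)$ of a graph $G$ with the property that in every $2$-colouring of $E(G)$ there is a monochromatic copy of $H$ which is an induced subgraph of $G$.
   Formalization: The explicit constant 10^25 Δ^3 log Δ (natural log) is claimed only for Δ ≥ 2, since for Δ = 1 it is 0 and the strict bound fails (e.g. a single edge) and for Δ = 0 log is undefined; finite graphs are taken with natural numbers as vertices. *)

theory Defs
  imports Complex_Main "HOL-Library.Extended_Nat"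
begin

definition graph :: "'a set \<times> 'a set set \<Rightarrow> bool" where
  "graph G \<longleftrightarrow> finite (fst G) \<and>
     (\<forall>e\<in>snd G. \<exists>u v. e = {u, v} \<and> u \<noteq> v \<and> u \<in> fst G \<and> v \<in> fst G)"

definition adj :: "'a set \<times> 'a set set \<Rightarrow> 'a \<Rightarrow> 'a \<Rightarrow> bool" where
  "adj G u v \<longleftrightarrow> {u, v} \<in> snd G"

definition num_edges :: "'a set \<times> 'a set set \<Rightarrow> nat" where
  "num_edges G = card (snd G)"

definition degree :: "'a set \<times> 'a set set \<Rightarrow> 'a \<Rightarrow> nat" where
  "degree G v = card {u \<in> fst G. adj G u v}"

definition max_degree_le :: "'a set \<times> 'a set set \<Rightarrow> nat \<Rightarrow> bool" where
  "max_degree_le G D \<longleftrightarrow> (\<forall>v\<in>fst G. degree G v \<le> D)"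

definition connected_graph :: "'a set \<times> 'a set set \<Rightarrow> bool" where
  "connected_graph G \<longleftrightarrow> fst G \<noteq> {} \<and>
     (\<forall>u\<in>fst G. \<forall>v\<in>fst G. (\<lambda>x y. adj G x y)\<^sup>*\<^sup>* u v)"

definition is_cycle :: "'a set \<times> 'a set set \<Rightarrow> 'a list \<Rightarrow> bool" where
  "is_cycle G cs \<longleftrightarrow> length cs \<ge> 3 \<and> distinct cs \<and> set cs \<subseteq> fst G \<and>
     (\<forall>i. Suc i < length cs \<longrightarrow> adj G (cs ! i) (cs ! Suc i)) \<and>
     adj G (last cs) (hd cs)"

definition acyclic_graph :: "'a set \<times> 'a set set \<Rightarrow> bool" where
  "acyclic_graph G \<longleftrightarrow> (\<nexists>cs. is_cycle G cs)"

definition tree :: "'a set \<times> 'a set set \<Rightarrow> bool" where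
  "tree T \<longleftrightarrow> graph T \<and> connected_graph T \<and> acyclic_graph T"

definition mono_induced_copy ::
  "'b set \<times> 'b set set \<Rightarrow> ('b set \<Rightarrow> bool) \<Rightarrow> 'a set \<times> 'a set set \<Rightarrow> bool" where
  "mono_induced_copy G c H \<longleftrightarrow>
     (\<exists>f. inj_on f (fst H) \<and> f ` fst H \<subseteq> fst G \<and>
        (\<forall>u\<in>fst H. \<forall>v\<in>fst H. u \<noteq> v \<longrightarrow> (adj G (f u) (f v) \<longleftrightarrow> adj H u v)) \<and>
        (\<exists>col. \<forall>e\<in>snd H. c (f ` e) = col))"

definition induced_ramsey :: "'b set \<times> 'b set set \<Rightarrow> 'a set \<times> 'a set set \<Rightarrow> bool" where
  "induced_ramsey G H \<longleftrightarrow> (\<forall>c :: 'b set \<Rightarrow> bool. mono_induced_copy G c H)"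

text \<open>Induced size Ramsey number, minimum over all finite graphs (host graphs on nat, which
  loses no generality); value \<infinity> if no such graph existed.\<close>
definition ind_size_ramsey :: "'a set \<times> 'a set set \<Rightarrow> enat" where
  "ind_size_ramsey H =
     (INF G \<in> {G :: nat set \<times> nat set set. graph G \<and> induced_ramsey G H}. enat (num_edges G))"

end

theory Submission
  imports Defs "HOL-Library.FuncSet"
begin

text \<open>
  The host is a sparse random bipartite graph with average degree of order \<open>\<Delta>\<close> on order
  \<open>\<Delta>\<^sup>2 n\<close> vertices. By a union bound it is locally sparse: for every set \<open>Q\<close> of at most
  \<open>2 n + 1\<close> vertices, few edges are spanned by \<open>Q\<close> and a bounded number of neighbours of each of its
  vertices, apart from a star forest rooted in \<open>Q\<close>. Given a 2-colouring, take a subgraph of large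
  minimum degree in the majority colour. The tree is embedded leaf by leaf. Along with the image one
  maintains a slightly larger set \<open>D\<close> of vertices, for each of which children are reserved so that all
  reserved children are pairwise non-adjacent in the host; a leaf is always embedded on a reserved
  child. Whenever too many candidate children of a vertex outside \<open>D\<close> clash with \<open>D\<close>, that vertex
  joins \<open>D\<close>. Local sparseness bounds \<open>D\<close> by twice the image and, by a degeneracy ordering of the
  newcomers, lets all of them reserve children at once.
\<close>

section \<open>Growing a tree leaf by leaf\<close>

text \<open>The uniqueness of \<open>u\<close> makes \<open>v\<close> a leaf of the enlarged tree,
  so an induced embedding has to join the image of \<open>v\<close> to a single earlier
  image.\<close>

inductive grows :: "'a set \<times> 'a set set \<Rightarrow> 'a \<Rightarrow> 'a set \<Rightarrow> bool" for T r where
  root: "grows T r {r}"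
| leaf: "grows T r Z \<Longrightarrow> v \<in> fst T \<Longrightarrow> v \<notin> Z \<Longrightarrow> u \<in> Z \<Longrightarrow> adj T u v \<Longrightarrow>
    (\<And>u'. u' \<in> Z \<Longrightarrow> adj T u' v \<Longrightarrow> u' = u) \<Longrightarrow> grows T r (insert v Z)"

text \<open>Paths are distinct vertex lists, so that appending one more vertex yields a list fit for
  \<open>is_cycle\<close>.\<close>

definition linked :: "'a set \<times> 'a set set \<Rightarrow> 'a set \<Rightarrow> 'a \<Rightarrow> 'a \<Rightarrow> bool" where
  "linked T Z x y \<longleftrightarrow> (\<exists>ps. ps \<noteq> [] \<and> distinct ps \<and> set ps \<subseteq> Z \<and> hd ps = x \<and> last ps = y \<and>
     successively (adj T) ps)"

lemma linked_refl: "x \<in> Z \<Longrightarrow> linked T Z x x"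
  unfolding linked_def by (intro exI[of _ "[x]"]) auto

lemma linked_mono: "linked T Z x y \<Longrightarrow> Z \<subseteq> Z' \<Longrightarrow> linked T Z' x y"
  unfolding linked_def by blast

lemma linked_sym:
  assumes "linked T Z x y"
  shows "linked T Z y x"
proof -
  obtain ps where ps: "ps \<noteq> []" "distinct ps" "set ps \<subseteq> Z" "hd ps = x" "last ps = y"
      "successively (adj T) ps"
    using assms unfolding linked_def by blast
  have "successively (adj T) (rev ps)"
    using ps(6) by (simp add: adj_def insert_commute)
  then show ?thesis
    unfolding linked_def using ps by (intro exI[of _ "rev ps"]) (simp add: hd_rev last_rev)
qed

lemma linked_insert:
  assumes "linked T Z x y" "v \<notin> Z" "adj T y v"
  shows "linked T (insert v Z) x v"
proof -
  obtain ps where ps: "ps \<noteq> []" "distinct ps" "set ps \<subseteq> Z" "hd ps = x" "last ps = y"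
      "successively (adj T) ps"
    using assms unfolding linked_def by blast
  then show ?thesis
    unfolding linked_def using assms
    by (intro exI[of _ "ps @ [v]"]) (auto simp: successively_append_iff)
qed

lemma grows_linked:
  assumes "grows T r Z" "x \<in> Z" "y \<in> Z"
  shows "linked T Z x y"
  using assms
proof (induction arbitrary: x y)
  case root
  then show ?case by (auto intro: linked_refl)
next
  case (leaf Z v u)
  have v: "linked T (insert v Z) x v" if "x \<in> Z" for x
    using leaf.IH[OF that \<open>u \<in> Z\<close>] \<open>v \<notin> Z\<close> \<open>adj T u v\<close> by (rule linked_insert)
  consider "x = v" "y = v" | "x = v" "y \<in> Z" | "x \<in> Z" "y = v" | "x \<in> Z" "y \<in> Z"
    using leaf.prems by blast
  then show ?case
  proof cases
    case 1
    then show ?thesis by (simp add: linked_refl)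
  next
    case 2
    then show ?thesis using linked_sym[OF v] by simp
  next
    case 3
    then show ?thesis using v by simp
  next
    case 4
    then show ?thesis using linked_mono[OF leaf.IH[OF 4] subset_insertI] by simp
  qed
qed

lemma grows_subset: "grows T r Z \<Longrightarrow> r \<in> fst T \<Longrightarrow> r \<in> Z \<and> Z \<subseteq> fst T"
  by (induction rule: grows.induct) auto

text \<open>A grown set of largest size is the whole tree: otherwise connectedness supplies an edge
  leaving it, and acyclicity makes the outer end an admissible leaf.\<close>

lemma tree_grows:
  assumes T: "tree T" and r: "r \<in> fst T"
  shows "grows T r (fst T)"
proof -
  have fin: "finite (fst T)" using T unfolding tree_def graph_def by auto
  have "\<exists>Z. grows T r Z \<and> (\<forall>Z'. grows T r Z' \<longrightarrow> card Z' \<le> card Z)"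
    using grows_subset[OF _ r] fin
    by (intro ex_has_greatest_nat[where k = "{r}" and b = "Suc (card (fst T))"])
       (auto intro: grows.root simp: less_Suc_eq_le card_mono)
  then obtain Z where Z: "grows T r Z" and max: "\<And>Z'. grows T r Z' \<Longrightarrow> card Z' \<le> card Z"
    by blast
  have ZT: "r \<in> Z" "Z \<subseteq> fst T" using grows_subset[OF Z r] by auto
  have finZ: "finite Z" using ZT fin finite_subset by blast
  have "Z = fst T"
  proof (rule ccontr)
    assume "Z \<noteq> fst T"
    then obtain y where y: "y \<in> fst T" "y \<notin> Z" using ZT by blast
    have "(\<lambda>x y. adj T x y)\<^sup>*\<^sup>* r y" using T r y unfolding tree_def connected_graph_def by blast
    then have "y \<in> Z \<or> (\<exists>u\<in>Z. \<exists>v. v \<notin> Z \<and> adj T u v)"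
      by (induction rule: rtranclp_induct) (use ZT in auto)
    then obtain u v where uv: "u \<in> Z" "v \<notin> Z" "adj T u v" using y by blast
    have vT: "v \<in> fst T"
      using T uv unfolding tree_def graph_def adj_def by (metis doubleton_eq_iff)
    \<comment> \<open>A second neighbour \<open>u'\<close> would close the path from
      \<open>u\<close> to \<open>u'\<close> inside \<open>Z\<close> into a cycle through
      \<open>v\<close>.\<close>
    have "u' = u" if u': "u' \<in> Z" "adj T u' v" for u'
    proof (rule ccontr)
      assume ne: "u' \<noteq> u"
      obtain ps where ps: "ps \<noteq> []" "distinct ps" "set ps \<subseteq> Z" "hd ps = u" "last ps = u'"
          "successively (adj T) ps"
        using grows_linked[OF Z \<open>u \<in> Z\<close> u'(1)] unfolding linked_def by blast
      \<comment> \<open>Distinct ends force two path vertices; with \<open>v\<close> these are the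
        three that a cycle needs.\<close>
      have "length ps \<noteq> 1"
        using ps ne by (auto simp: length_Suc_conv)
      then have "length ps \<ge> 2" using ps(1) by (cases ps) (auto simp: Suc_le_eq)
      moreover have "successively (adj T) (ps @ [v])"
        using ps u' by (auto simp: successively_append_iff)
      moreover have "adj T v u" using uv by (simp add: adj_def insert_commute)
      ultimately have "is_cycle T (ps @ [v])"
        unfolding is_cycle_def using ps uv vT ZT
        by (auto simp: successively_conv_nth)
      then show False using T unfolding tree_def acyclic_graph_def by blast
    qed
    then have "grows T r (insert v Z)" using grows.leaf[OF Z vT] uv by blast
    then show False using max finZ uv by fastforce
  qed
  then show ?thesis using Z by simp
qed

section \<open>Embedding induced trees with reserved children\<close>

text \<open>If \<open>w\<close> is not a clash, it may be reserved as a child of \<open>v\<close> whatever children in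
  \<open>nb u\<close> the other vertices \<open>u\<close> of \<open>D\<close> get.\<close>

definition clashes :: "('b \<Rightarrow> 'b \<Rightarrow> bool) \<Rightarrow> ('b \<Rightarrow> 'b set) \<Rightarrow> 'b set \<Rightarrow> 'b \<Rightarrow> 'b set" where
  "clashes A nb D v = {w \<in> nb v. \<exists>u\<in>D - {v}. w = u \<or> A w u \<or> (\<exists>w'\<in>nb u - {v}. A w w')}"

text \<open>\<open>A\<close> is adjacency in the whole host, while \<open>nb v\<close> will be a
  chosen set of neighbours in one colour and need not be symmetric. The budget 4\<theta> splits into
  \<theta> children to reserve, 2\<theta> clashes with \<open>D\<close> and \<theta> clashes with
  newcomers.\<close>

locale sparse_host =
  fixes A :: "'b \<Rightarrow> 'b \<Rightarrow> bool" and U :: "'b set" and nb :: "'b \<Rightarrow> 'b set" and \<theta> n :: nat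
  assumes finite_U: "finite U" and U_ne: "U \<noteq> {}"
    and sym: "A x y \<Longrightarrow> A y x"
    and triangle_free: "A v x \<Longrightarrow> A v y \<Longrightarrow> \<not> A x y"
    and nb_subset: "v \<in> U \<Longrightarrow> nb v \<subseteq> U"
    and nb_adj: "v \<in> U \<Longrightarrow> w \<in> nb v \<Longrightarrow> A v w"
    and card_nb: "v \<in> U \<Longrightarrow> card (nb v) = 4 * \<theta>"
    and sparse: "Q \<subseteq> U \<Longrightarrow> Q \<noteq> {} \<Longrightarrow> card Q \<le> 2 * n + 1 \<Longrightarrow>
      (\<Sum>v\<in>Q. card (clashes A nb Q v)) \<le> \<theta> * card Q"
begin

abbreviation clash :: "'b set \<Rightarrow> 'b \<Rightarrow> 'b set" where
  "clash \<equiv> clashes A nb"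

lemma finite_nb: "v \<in> U \<Longrightarrow> finite (nb v)"
  using nb_subset finite_U by (meson finite_subset)

lemma finite_clash: "v \<in> U \<Longrightarrow> finite (clash D v)"
  unfolding clashes_def using finite_nb by auto

lemma clash_mono: "D \<subseteq> D' \<Longrightarrow> clash D v \<subseteq> clash D' v"
  unfolding clashes_def by blast

lemma clash_insert_self: "clash (insert v D) v = clash D v"
  unfolding clashes_def by auto

text \<open>The exceptions \<open>x = p'\<close> and \<open>y = p\<close> occur when a vertex of \<open>D\<close> is itself reserved as a child
  of another one; such an adjacency is a tree edge.\<close>

definition reserved :: "'b \<Rightarrow> 'b set \<Rightarrow> ('b \<Rightarrow> 'b set) \<Rightarrow> bool" where
  "reserved r D R \<longleftrightarrow> r \<in> D \<and> D \<subseteq> U \<and>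
     (\<forall>p\<in>D. R p \<subseteq> nb p \<and> card (R p) = \<theta>) \<and>
     (\<forall>p\<in>D. \<forall>p'\<in>D. p \<noteq> p' \<longrightarrow> R p \<inter> R p' = {}) \<and>
     (\<forall>p\<in>D. \<forall>p'\<in>D. p \<noteq> p' \<longrightarrow> (\<forall>x\<in>R p. \<forall>y\<in>R p'. A x y \<longrightarrow> x = p' \<or> y = p)) \<and>
     (\<forall>p\<in>D. p \<noteq> r \<longrightarrow> r \<notin> R p \<and> (\<forall>x\<in>R p. \<not> A x r))"

text \<open>Every vertex of \<open>D\<close> outside the image of the \<open>z\<close> embedded tree vertices joined \<open>D\<close> because it
  had at least \<open>2 * \<theta>\<close> clashes; sparseness then keeps \<open>D\<close> at most twice as large as the image.\<close>

definition potential :: "nat \<Rightarrow> 'b set \<Rightarrow> bool" where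
  "potential z D \<longleftrightarrow> 2 * \<theta> * card D \<le> 2 * \<theta> * z + (\<Sum>v\<in>D. card (clash D v))"

definition closed_under_clash :: "'b set \<Rightarrow> bool" where
  "closed_under_clash D \<longleftrightarrow> (\<forall>v\<in>U - D. card (clash D v) \<le> 2 * \<theta>)"

section \<open>Extending a reservation to new vertices\<close>

lemma reserved_extend_one:
  assumes R: "reserved r D R" and v: "v \<in> U - D" and c: "card (clash D v) \<le> 3 * \<theta>"
  shows "\<exists>S. reserved r (insert v D) (R(v := S))"
proof -
  \<comment> \<open>Of the 4\<theta> candidates at most 3\<theta> clash.\<close>
  have "\<theta> \<le> card (nb v - clash D v)"
    using diff_card_le_card_Diff[OF finite_clash[of v D], of "nb v"] card_nb[of v] v c by auto
  then obtain S where S: "S \<subseteq> nb v - clash D v" "card S = \<theta>"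
    by (metis obtain_subset_with_card_n)
  \<comment> \<open>Avoiding clashes excludes every conflict with \<open>D\<close> except one
    through \<open>v\<close> itself, which may already be a reserved child of \<open>p\<close>; this
    is the exception that \<open>reserved\<close> admits.\<close>
  have ok: "x \<noteq> p \<and> \<not> A x p \<and> (\<forall>w'\<in>nb p. A x w' \<longrightarrow> w' = v)" if "x \<in> S" "p \<in> D" for x p
    using that S v unfolding clashes_def by auto
  have DU: "D \<subseteq> U" and rD: "r \<in> D" and RD: "\<And>p. p \<in> D \<Longrightarrow> R p \<subseteq> nb p"
    using R unfolding reserved_def by auto
  have disj: "S \<inter> R p = {}" if "p \<in> D" for p
    using ok[OF _ that] RD[OF that] nb_adj[of p] DU that sym by blast
  have conf: "y = v" if "p \<in> D" "x \<in> S" "y \<in> R p" "A x y" for p x y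
    using ok[OF that(2) that(1)] RD[OF that(1)] that by blast
  have conf': "y = v" if "p \<in> D" "x \<in> S" "y \<in> R p" "A y x" for p x y
    using conf[OF that(1-3)] sym that(4) by blast
  let ?R = "R(v := S)"
  have R_old: "?R p = R p" if "p \<in> D" for p
    using that v by auto
  have "?R p \<subseteq> nb p \<and> card (?R p) = \<theta>" if "p \<in> insert v D" for p
    using that S R R_old unfolding reserved_def by auto
  moreover have "?R p \<inter> ?R p' = {}" if "p \<in> insert v D" "p' \<in> insert v D" "p \<noteq> p'" for p p'
    using that disj R_old R unfolding reserved_def by (cases "p = v"; cases "p' = v") auto
  moreover have "x = p' \<or> y = p"
    if "p \<in> insert v D" "p' \<in> insert v D" "p \<noteq> p'" "x \<in> ?R p" "y \<in> ?R p'" "A x y" for p p' x y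
  proof (cases "p = v")
    case True
    then show ?thesis using that conf[of p' x y] by auto
  next
    case p: False
    show ?thesis
    proof (cases "p' = v")
      case True
      then show ?thesis using that p conf'[of p y x] by auto
    next
      case False
      then show ?thesis using that p R unfolding reserved_def by auto
    qed
  qed
  moreover have "r \<notin> ?R p \<and> (\<forall>x\<in>?R p. \<not> A x r)" if "p \<in> insert v D" "p \<noteq> r" for p
    using that ok[OF _ rD] R unfolding reserved_def by (cases "p = v") auto
  ultimately show ?thesis
    unfolding reserved_def using rD DU v by (intro exI[of _ S]) auto
qed

text \<open>Degeneracy argument: each nonempty part of \<open>E\<close> has a vertex with few
  clashes inside it, which is removed and served after the others. Leaving \<open>R\<close>
  unchanged on \<open>D\<close> keeps images already placed on reserved children valid.\<close>

lemma reserved_extend: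
  assumes "reserved r D R" "closed_under_clash D"
    and "E \<subseteq> U" "E \<inter> D = {}" "card E \<le> 2 * n + 1"
  shows "\<exists>R'. reserved r (D \<union> E) R' \<and> (\<forall>p\<in>D. R' p = R p)"
  using assms(3-5)
proof (induction "card E" arbitrary: E)
  case 0
  then have "E = {}" using finite_U finite_subset by (metis card_0_eq)
  then show ?case using assms(1) by auto
next
  case (Suc c)
  have finE: "finite E" using Suc.prems finite_U finite_subset by blast
  have "E \<noteq> {}" using Suc.hyps by auto
  have "\<exists>v\<in>E. card (clash E v) \<le> \<theta>"
  proof (rule ccontr)
    assume "\<not> ?thesis"
    then have "(\<Sum>v\<in>E. \<theta>) < (\<Sum>v\<in>E. card (clash E v))"
      using finE \<open>E \<noteq> {}\<close> by (intro sum_strict_mono) auto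
    then show False using sparse[of E] Suc.prems \<open>E \<noteq> {}\<close> by (simp add: mult.commute)
  qed
  then obtain v where v: "v \<in> E" "card (clash E v) \<le> \<theta>" by blast
  \<comment> \<open>Such a \<open>v\<close> is served last: it loses \<open>2 * \<theta>\<close> candidates to \<open>D\<close> and \<open>\<theta>\<close> to the rest of \<open>E\<close>.\<close>
  let ?E = "E - {v}"
  have "\<exists>R'. reserved r (D \<union> ?E) R' \<and> (\<forall>p\<in>D. R' p = R p)"
    using Suc.hyps(2) Suc.prems v finE by (intro Suc.hyps(1)) auto
  then obtain R' where R': "reserved r (D \<union> ?E) R'" "\<forall>p\<in>D. R' p = R p" by blast
  \<comment> \<open>Each clash is caused by a single vertex, so the clashes with a union
    split.\<close>
  have "clash (D \<union> ?E) v \<subseteq> clash D v \<union> clash E v"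
    unfolding clashes_def by blast
  then have "card (clash (D \<union> ?E) v) \<le> card (clash D v) + card (clash E v)"
    using v Suc.prems finite_clash by (meson card_Un_le card_mono finite_UnI le_trans subsetD)
  also have "\<dots> \<le> 2 * \<theta> + \<theta>"
    using v Suc.prems assms(2) unfolding closed_under_clash_def by (intro add_mono) auto
  finally obtain S where S: "reserved r (insert v (D \<union> ?E)) (R'(v := S))"
    using reserved_extend_one[OF R'(1), of v] v Suc.prems by auto
  moreover have "insert v (D \<union> ?E) = D \<union> E" using v by auto
  moreover have "\<forall>p\<in>D. (R'(v := S)) p = R p" using R' v Suc.prems by auto
  ultimately show ?case by metis
qed

section \<open>Bounding the size of \<open>D\<close> by the potential\<close>

lemma potential_card_le:
  assumes "potential z D" "D \<subseteq> U" "card D \<le> 2 * n + 1" "\<theta> > 0"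
  shows "card D \<le> 2 * z"
proof (cases "D = {}")
  case False
  \<comment> \<open>\<open>sparse\<close> bounds the clash sum by half of the left-hand side of
    \<open>potential\<close>; cancelling that half costs the factor 2.\<close>
  then have "2 * \<theta> * card D \<le> 2 * \<theta> * z + \<theta> * card D"
    using assms sparse[of D] unfolding potential_def by linarith
  then have "\<theta> * card D \<le> \<theta> * (2 * z)" by (simp add: algebra_simps)
  then show ?thesis using \<open>\<theta> > 0\<close> by simp
qed auto

text \<open>The clashes of \<open>v\<close> pay for its own cost 2\<theta>: inserting
  \<open>v\<close> does not change them, and those of other vertices can only grow.\<close>

lemma potential_insert:
  assumes "potential z D" "D \<subseteq> U" "v \<in> U - D" "card (clash D v) \<ge> 2 * \<theta>"
  shows "potential z (insert v D)"
proof -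
  have fin: "finite D" using assms finite_U finite_subset by blast
  have "(\<Sum>u\<in>D. card (clash D u)) \<le> (\<Sum>u\<in>D. card (clash (insert v D) u))"
    using assms clash_mono[of D "insert v D"] finite_clash by (intro sum_mono card_mono) auto
  then show ?thesis
    using assms fin unfolding potential_def by (simp add: clash_insert_self)
qed

text \<open>Here the additional embedded tree vertex pays for \<open>v\<close>, whatever its number
  of clashes.\<close>

lemma potential_Suc_insert:
  assumes "potential z D" "D \<subseteq> U"
  shows "potential (Suc z) (insert v D)"
proof -
  have fin: "finite D" using assms finite_U finite_subset by blast
  have "(\<Sum>u\<in>D. card (clash D u)) \<le> (\<Sum>u\<in>D. card (clash (insert v D) u))"
    using assms clash_mono[of D "insert v D"] finite_clash by (intro sum_mono card_mono) auto
  then show ?thesis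
    using assms fin unfolding potential_def by (cases "v \<in> D") (auto simp: insert_absorb)
qed

text \<open>A largest admissible superset is closed, since a vertex with more than 2\<theta> clashes
  could still be added.\<close>

lemma closure_exists:
  assumes "potential z D" "D \<subseteq> U" "card D \<le> 2 * n + 1" "z \<le> n" "\<theta> > 0"
  shows "\<exists>D'. D \<subseteq> D' \<and> D' \<subseteq> U \<and> card D' \<le> 2 * n + 1 \<and> potential z D' \<and> closed_under_clash D'"
proof -
  let ?P = "\<lambda>D'. D \<subseteq> D' \<and> D' \<subseteq> U \<and> card D' \<le> 2 * n + 1 \<and> potential z D'"
  have "\<exists>D'. ?P D' \<and> (\<forall>D''. ?P D'' \<longrightarrow> card D'' \<le> card D')"
    using assms by (intro ex_has_greatest_nat[where k = D and b = "2 * n + 2"]) auto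
  then obtain D' where D': "?P D'" and max: "\<And>D''. ?P D'' \<Longrightarrow> card D'' \<le> card D'" by blast
  have fin: "finite D'" using D' finite_U finite_subset by blast
  have "closed_under_clash D'"
    unfolding closed_under_clash_def
  proof (rule ballI, rule ccontr)
    fix v assume v: "v \<in> U - D'" "\<not> card (clash D' v) \<le> 2 * \<theta>"
    \<comment> \<open>The potential improves the size bound by one, which leaves room to insert
      \<open>v\<close> within the range of \<open>sparse\<close>; hence the \<open>+ 1\<close>
      there.\<close>
    have "card D' \<le> 2 * n"
      using potential_card_le[of z D'] D' assms by fastforce
    then have "?P (insert v D')"
      using D' v fin potential_insert[of z D' v] by auto
    from max[OF this] show False using v fin by auto
  qed
  then show ?thesis using D' by blast
qed

section \<open>The embedding invariant and its extension by a leaf\<close>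

definition embedded :: "'a set \<times> 'a set set \<Rightarrow> 'a \<Rightarrow> 'a set \<Rightarrow> ('a \<Rightarrow> 'b) \<Rightarrow> 'b set \<Rightarrow>
    ('b \<Rightarrow> 'b set) \<Rightarrow> bool" where
  "embedded T r Z f D R \<longleftrightarrow> inj_on f Z \<and> f ` Z \<subseteq> D \<and>
     (\<forall>u\<in>Z. \<forall>v\<in>Z. u \<noteq> v \<longrightarrow> (A (f u) (f v) \<longleftrightarrow> adj T u v)) \<and>
     (\<forall>u\<in>Z. \<forall>v\<in>Z. u \<noteq> v \<longrightarrow> adj T u v \<longrightarrow> f v \<in> nb (f u) \<or> f u \<in> nb (f v)) \<and>
     reserved (f r) D R \<and>
     (\<forall>s\<in>f ` Z. s \<noteq> f r \<longrightarrow> (\<exists>p\<in>f ` Z. s \<in> R p)) \<and>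
     closed_under_clash D \<and> card D \<le> 2 * n + 1 \<and> potential (card Z) D"

lemma embedded_root:
  fixes T :: "'a set \<times> 'a set set"
  assumes "\<theta> > 0" "n > 0"
  shows "\<exists>f D R. embedded T r {r} f D R"
proof -
  obtain r0 where r0: "r0 \<in> U" using U_ne by blast
  obtain S where S: "S \<subseteq> nb r0" "card S = \<theta>"
    using obtain_subset_with_card_n[of \<theta> "nb r0"] card_nb[OF r0] by auto
  \<comment> \<open>Sparseness of the pair \<open>{v, r0}\<close> already limits the clashes of
    \<open>v\<close> to 2\<theta>.\<close>
  have "card (clash {r0} v) \<le> 2 * \<theta>" if v: "v \<in> U - {r0}" for v
  proof -
    have "(\<Sum>u\<in>{v, r0}. card (clash {v, r0} u)) \<le> \<theta> * card {v, r0}"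
      using v r0 assms by (intro sparse) (auto simp: card_insert_if)
    then have "card (clash {v, r0} v) \<le> 2 * \<theta>" using v by (simp add: card_insert_if)
    then show ?thesis using clash_insert_self[of v "{r0}"] by simp
  qed
  then have "embedded T r {r} (\<lambda>_. r0) {r0} (\<lambda>_. S)"
    unfolding embedded_def reserved_def closed_under_clash_def potential_def
    using r0 S assms by auto
  then show ?thesis by blast
qed

lemma embedded_leaf:
  fixes T :: "'a set \<times> 'a set set"
  assumes emb: "embedded T r Z f D R"
    and T: "graph T" "card (fst T) = n" "max_degree_le T \<theta>" "\<theta> > 0"
    and Z: "Z \<subseteq> fst T" "r \<in> Z" and v: "v \<in> fst T" "v \<notin> Z" and u: "u \<in> Z" "adj T u v"
    and uniq: "\<And>u'. u' \<in> Z \<Longrightarrow> adj T u' v \<Longrightarrow> u' = u"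
  shows "\<exists>f D R. embedded T r (insert v Z) f D R"
proof -
  have finT: "finite (fst T)" using T unfolding graph_def by auto
  then have finZ: "finite Z" using Z finite_subset by blast
  have inj: "inj_on f Z" and fD: "f ` Z \<subseteq> D"
    and ind: "\<And>x y. x \<in> Z \<Longrightarrow> y \<in> Z \<Longrightarrow> x \<noteq> y \<Longrightarrow> A (f x) (f y) \<longleftrightarrow> adj T x y"
    and edge: "\<And>x y. x \<in> Z \<Longrightarrow> y \<in> Z \<Longrightarrow> x \<noteq> y \<Longrightarrow> adj T x y \<Longrightarrow> f y \<in> nb (f x) \<or> f x \<in> nb (f y)"
    and res: "reserved (f r) D R"
    and par: "\<And>s. s \<in> f ` Z \<Longrightarrow> s \<noteq> f r \<Longrightarrow> \<exists>p\<in>f ` Z. s \<in> R p"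
    and closed: "closed_under_clash D" and cardD: "card D \<le> 2 * n + 1"
    and pot: "potential (card Z) D"
    using emb unfolding embedded_def by auto
  have DU: "D \<subseteq> U" using res unfolding reserved_def by auto
  define p where "p = f u"
  have p: "p \<in> f ` Z" "p \<in> D" "p \<in> U" using u fD DU p_def by auto
  have Rp: "R p \<subseteq> nb p" "card (R p) = \<theta>" using res p unfolding reserved_def by auto
  \<comment> \<open>Used children of \<open>p\<close> are images of neighbours of \<open>u\<close>.
    As \<open>v\<close> is a further neighbour outside \<open>Z\<close>, using all \<theta> children
    would exceed the degree bound.\<close>
  have "\<not> R p \<subseteq> f ` Z"
  proof
    assume sub: "R p \<subseteq> f ` Z"
    let ?C = "{z \<in> Z. f z \<in> R p}"
    have "R p = f ` ?C" using sub by auto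
    then have "\<theta> \<le> card ?C" using Rp(2) finZ
      by (metis (lifting) card_image_le finite_Collect_conjI finite_subset mem_Collect_eq subsetI)
    moreover have "?C \<subset> {w \<in> fst T. adj T w u}"
    proof
      show "?C \<subseteq> {w \<in> fst T. adj T w u}"
      proof
        fix z assume z: "z \<in> ?C"
        then have a: "A p (f z)" using Rp nb_adj p by blast
        then have "z \<noteq> u" using triangle_free p_def by blast
        then show "z \<in> {w \<in> fst T. adj T w u}" using ind[of z u] z a sym u Z p_def by blast
      qed
      show "?C \<noteq> {w \<in> fst T. adj T w u}"
      proof -
        have "adj T v u" using u by (simp add: adj_def insert_commute)
        then show ?thesis using v by blast
      qed
    qed
    then have "card ?C < card {w \<in> fst T. adj T w u}"
      using finT by (intro psubset_card_mono) auto
    moreover have "card {w \<in> fst T. adj T w u} \<le> \<theta>"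
      using T u Z unfolding max_degree_le_def degree_def by auto
    ultimately show False by simp
  qed
  then obtain w where w: "w \<in> R p" "w \<notin> f ` Z" by blast
  have wU: "w \<in> U" and Apw: "A p w" using w Rp p nb_subset nb_adj by auto
  have nonadj: "\<not> A w s" if s: "s \<in> f ` Z" "s \<noteq> p" for s
  proof
    assume a: "A w s"
    \<comment> \<open>The root has no parent that reserved it, so it is handled by the last clause
      of \<open>reserved\<close>.\<close>
    have "s \<noteq> f r"
      using a res p w s unfolding reserved_def by metis
    then obtain p' where p': "p' \<in> f ` Z" "s \<in> R p'" using par s by blast
    show False
    \<comment> \<open>Children of the same vertex are non-adjacent by triangle-freeness. For
      different parents both exceptions fail: \<open>w\<close> is not an image, and \<open>s\<close>
      is not \<open>p\<close>.\<close>
    proof (cases "p' = p")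
      case True
      then have "A p s" using p' Rp p nb_adj by blast
      then show False using a triangle_free[OF Apw] by blast
    next
      case False
      have "\<forall>p\<in>D. \<forall>p'\<in>D. p \<noteq> p' \<longrightarrow> (\<forall>x\<in>R p. \<forall>y\<in>R p'. A x y \<longrightarrow> x = p' \<or> y = p)"
        using res unfolding reserved_def by (elim conjE)
      moreover have "p' \<in> D" using p' fD by blast
      ultimately have "w = p' \<or> s = p"
        using a p(2) p'(2) w(1) False by metis
      then show False using w p' s by auto
    qed
  qed
  define g where "g = f(v := w)"
  have g: "g x = f x" if "x \<in> Z" for x using that v g_def by auto
  have gv: "g v = w" using g_def by auto
  have gZ: "g ` insert v Z = insert w (f ` Z)" using g gv by auto
  have cZ: "card (insert v Z) = Suc (card Z)" using finZ v by auto
  have leq: "card (insert v Z) \<le> n" using Z v finT T by (metis card_mono insert_subset)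
  have "potential (Suc (card Z)) (insert w D)" using potential_Suc_insert[OF pot DU] .
  moreover have "card (insert w D) \<le> 2 * n + 1"
  proof -
    have "card D \<le> 2 * card Z" using potential_card_le[OF pot DU cardD] T by simp
    then show ?thesis using leq cZ card_insert_le_m1[of "2 * n + 1" D w] by auto
  qed
  ultimately obtain D' where D': "insert w D \<subseteq> D'" "D' \<subseteq> U" "card D' \<le> 2 * n + 1"
      "potential (Suc (card Z)) D'" "closed_under_clash D'"
    using closure_exists[of "Suc (card Z)" "insert w D"] wU DU leq cZ T by auto
  have finD': "finite D'" using D' finite_U finite_subset by blast
  \<comment> \<open>The newcomers rely on the closedness of the old \<open>D\<close>; that of
    \<open>D'\<close> is for the next leaf.\<close>
  have "\<exists>R'. reserved (f r) (D \<union> (D' - D)) R' \<and> (\<forall>p\<in>D. R' p = R p)"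
    using D' finD' card_mono[OF finD', of "D' - D"] by (intro reserved_extend[OF res closed]) auto
  moreover have "D \<union> (D' - D) = D'" using D' by auto
  ultimately obtain R' where R': "reserved (f r) D' R'" "\<And>p. p \<in> D \<Longrightarrow> R' p = R p" by auto
  have "inj_on g (insert v Z)"
    unfolding inj_on_insert gv using inj w v g_def by (auto simp: inj_on_fun_updI)
  moreover have "A (g x) (g y) \<longleftrightarrow> adj T x y"
    if xy: "x \<in> insert v Z" "y \<in> insert v Z" "x \<noteq> y" for x y
  proof -
    have key: "A w (f z) \<longleftrightarrow> adj T v z" "A (f z) w \<longleftrightarrow> adj T z v" if z: "z \<in> Z" for z
    proof -
      have s: "A w (f z) \<longleftrightarrow> A (f z) w" "adj T v z \<longleftrightarrow> adj T z v"
        using sym by (auto simp: adj_def insert_commute)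
      show "A (f z) w \<longleftrightarrow> adj T z v"
      proof (cases "z = u")
        case True then show ?thesis using Apw u p_def by auto
      next
        case False
        then have "f z \<noteq> p" using inj z u p_def by (auto dest: inj_onD)
        then have "\<not> A (f z) w" using nonadj z s by blast
        then show ?thesis using uniq[OF z] False by auto
      qed
      then show "A w (f z) \<longleftrightarrow> adj T v z" using s by simp
    qed
    consider "x = v" "y \<in> Z" | "x \<in> Z" "y = v" | "x \<in> Z" "y \<in> Z" using xy by blast
    then show ?thesis by cases (simp_all add: g gv key ind xy(3))
  qed
  moreover have "g y \<in> nb (g x) \<or> g x \<in> nb (g y)"
    if xy: "x \<in> insert v Z" "y \<in> insert v Z" "x \<noteq> y" "adj T x y" for x y
  proof -
    have key: "w \<in> nb (f z)" if "z \<in> Z" "adj T z v" for z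
      using uniq[OF that] w Rp p_def by auto
    have "adj T y x" using xy(4) by (simp add: adj_def insert_commute)
    consider "x = v" "y \<in> Z" | "x \<in> Z" "y = v" | "x \<in> Z" "y \<in> Z" using xy by blast
    then show ?thesis
      by cases (use \<open>adj T y x\<close> xy in \<open>simp_all add: g gv key edge\<close>)
  qed
  moreover have "\<exists>q\<in>g ` insert v Z. s \<in> R' q" if "s \<in> g ` insert v Z" "s \<noteq> g r" for s
  proof (cases "s = w")
    case True
    then show ?thesis using w R'(2)[OF p(2)] p gZ by auto
  next
    case False
    then have "s \<in> f ` Z" "s \<noteq> f r" using that gZ g Z by auto
    then show ?thesis using par[of s] R'(2) fD gZ by (metis insertCI subsetD)
  qed
  ultimately have "embedded T r (insert v Z) g D' R'"
    unfolding embedded_def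
    unfolding g[OF Z(2)] gZ cZ using R'(1) D' order_trans[OF fD]
    by (intro conjI ballI impI) simp_all
  then show ?thesis by blast
qed

lemma embedded_grows:
  fixes T :: "'a set \<times> 'a set set"
  assumes "grows T r Z" "r \<in> fst T"
    and T: "graph T" "card (fst T) = n" "max_degree_le T \<theta>" "\<theta> > 0"
  shows "Z \<subseteq> fst T \<and> r \<in> Z \<and> (\<exists>f D R. embedded T r Z f D R)"
  using assms(1)
proof induction
  case root
  have "n > 0" using assms unfolding graph_def by (auto simp: card_gt_0_iff)
  then show ?case using embedded_root[of T r] assms by auto
next
  case (leaf Z v u)
  then obtain f D R where "embedded T r Z f D R" by blast
  then have "\<exists>f D R. embedded T r (insert v Z) f D R"
    using embedded_leaf[OF _ T _ _ leaf.hyps(2-6)] leaf.IH by blast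
  then show ?case using leaf by auto
qed

theorem tree_embeds:
  fixes T :: "'a set \<times> 'a set set"
  assumes T: "tree T" "card (fst T) = n" "max_degree_le T \<theta>" "\<theta> > 0"
  shows "\<exists>f. inj_on f (fst T) \<and> f ` fst T \<subseteq> U \<and>
     (\<forall>u\<in>fst T. \<forall>v\<in>fst T. u \<noteq> v \<longrightarrow> (A (f u) (f v) \<longleftrightarrow> adj T u v)) \<and>
     (\<forall>u\<in>fst T. \<forall>v\<in>fst T. u \<noteq> v \<longrightarrow> adj T u v \<longrightarrow> f v \<in> nb (f u) \<or> f u \<in> nb (f v))"
proof -
  obtain r where r: "r \<in> fst T" using T unfolding tree_def connected_graph_def by blast
  have "graph T" using T unfolding tree_def by blast
  then obtain f D R where "embedded T r (fst T) f D R"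
    using embedded_grows[OF tree_grows[OF T(1) r] r] T by blast
  then have "inj_on f (fst T)" "f ` fst T \<subseteq> D" "D \<subseteq> U"
    "\<forall>u\<in>fst T. \<forall>v\<in>fst T. u \<noteq> v \<longrightarrow> (A (f u) (f v) \<longleftrightarrow> adj T u v)"
    "\<forall>u\<in>fst T. \<forall>v\<in>fst T. u \<noteq> v \<longrightarrow> adj T u v \<longrightarrow> f v \<in> nb (f u) \<or> f u \<in> nb (f v)"
    unfolding embedded_def reserved_def by simp_all
  then show ?thesis by (intro exI[of _ f] conjI) auto
qed

end

section \<open>Locally sparse bipartite hosts\<close>

definition sym_adj :: "('b \<times> 'b) set \<Rightarrow> 'b \<Rightarrow> 'b \<Rightarrow> bool" where
  "sym_adj E x y \<longleftrightarrow> (x, y) \<in> E \<or> (y, x) \<in> E"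

definition incident :: "('b \<times> 'b) set \<Rightarrow> 'b set \<Rightarrow> ('b \<times> 'b) set" where
  "incident E Q = {(a, b) \<in> E. a \<in> Q \<or> b \<in> Q}"

definition touched :: "'b set \<Rightarrow> ('b \<times> 'b) set \<Rightarrow> 'b set" where
  "touched Q F = Q \<union> fst ` F \<union> snd ` F"

text \<open>For \<open>F\<close> a forest of stars with centres in \<open>Q\<close>, the edges spanned by \<open>Q\<close> and the leaves
  exceed \<open>F\<close> by fewer than \<open>k * card Q\<close>.\<close>

definition locally_sparse :: "'b set \<Rightarrow> ('b \<times> 'b) set \<Rightarrow> nat \<Rightarrow> nat \<Rightarrow> nat \<Rightarrow> bool" where
  "locally_sparse V E \<delta> k m \<longleftrightarrow> (\<forall>Q F. Q \<subseteq> V \<longrightarrow> Q \<noteq> {} \<longrightarrow> card Q \<le> m \<longrightarrow> F \<subseteq> incident E Q \<longrightarrow>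
     card F \<le> \<delta> * card Q \<longrightarrow> card (E \<inter> touched Q F \<times> touched Q F - F) < k * card Q)"

definition host :: "'b set \<Rightarrow> ('b \<times> 'b) set \<Rightarrow> 'b set \<times> 'b set set" where
  "host V E = (V, (\<lambda>(a, b). {a, b}) ` E)"

lemma adj_host: "adj (host V E) x y \<longleftrightarrow> sym_adj E x y"
  unfolding adj_def host_def sym_adj_def by (auto simp: doubleton_eq_iff)

lemma sym_adj_sym: "sym_adj E x y \<Longrightarrow> sym_adj E y x"
  unfolding sym_adj_def by auto

locale bipartite =
  fixes L B :: "'b set" and E :: "('b \<times> 'b) set"
  assumes finite_L: "finite L" and finite_B: "finite B"
    and disjoint: "L \<inter> B = {}" and E_subset: "E \<subseteq> L \<times> B"
begin

lemma finite_E: "finite E"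
  using finite_L finite_B E_subset by (meson finite_SigmaI finite_subset)

definition orient :: "'b \<Rightarrow> 'b \<Rightarrow> 'b \<times> 'b" where
  "orient u v = (if u \<in> L then (u, v) else (v, u))"

lemma orient_in_E: "sym_adj E u v \<Longrightarrow> orient u v \<in> E"
  using disjoint E_subset unfolding sym_adj_def orient_def by auto

lemma orient_eq: "orient u v = orient x y \<Longrightarrow> {u, v} = {x, y}"
  unfolding orient_def by (auto split: if_splits)

lemma triangle_free: "sym_adj E v x \<Longrightarrow> sym_adj E v y \<Longrightarrow> \<not> sym_adj E x y"
  using disjoint E_subset unfolding sym_adj_def by blast

text \<open>Give each candidate child outside \<open>Q\<close> one parent in \<open>Q\<close>; the
  parent edges form the star forest \<open>F\<close>. Every clashing pair can be charged injectively
  to a directed edge outside \<open>F\<close> on the touched vertices, and local sparseness bounds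
  these.\<close>

lemma sum_clashes_le:
  assumes sparse: "locally_sparse V E \<delta> k m"
    and Q: "Q \<subseteq> V" "Q \<noteq> {}" "finite Q" "card Q \<le> m"
    and nb: "\<And>v. v \<in> Q \<Longrightarrow> finite (nb v) \<and> card (nb v) \<le> \<delta>"
    and nb_adj: "\<And>v w. v \<in> Q \<Longrightarrow> w \<in> nb v \<Longrightarrow> sym_adj E v w"
  shows "(\<Sum>v\<in>Q. card (clashes (sym_adj E) nb Q v)) \<le> 2 * k * card Q"
proof -
  define X where "X = (\<Union>v\<in>Q. nb v) - Q"
  have "\<exists>v\<in>Q. w \<in> nb v" if "w \<in> X" for w using that X_def by auto
  then obtain \<pi> where \<pi>: "\<And>w. w \<in> X \<Longrightarrow> \<pi> w \<in> Q \<and> w \<in> nb (\<pi> w)" by metis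
  define F where "F = (\<lambda>w. orient (\<pi> w) w) ` X"
  have finX: "finite X" unfolding X_def using Q nb by auto
  have "card X \<le> (\<Sum>v\<in>Q. card (nb v))"
    unfolding X_def using Q nb card_UN_le[of Q nb]
    by (meson Diff_subset card_mono finite_UN_I le_trans)
  also have "\<dots> \<le> \<delta> * card Q"
    using nb sum_bounded_above[of Q "\<lambda>v. card (nb v)" \<delta>] by (simp add: mult.commute)
  finally have cardF: "card F \<le> \<delta> * card Q"
    unfolding F_def using card_image_le[OF finX] le_trans by blast
  have "orient (\<pi> w) w \<in> incident E Q" if "w \<in> X" for w
    using \<pi>[OF that] orient_in_E[OF nb_adj, of "\<pi> w" w]
    unfolding incident_def orient_def by (auto split: if_splits)
  then have F_inc: "F \<subseteq> incident E Q" unfolding F_def by auto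
  have F_iff: "\<exists>x\<in>X. {y, z} = {\<pi> x, x}" if "orient y z \<in> F" for y z
    using that orient_eq unfolding F_def by blast
  define Y where "Y = touched Q F"
  have "x \<in> Y" if "x \<in> X" for x
  proof -
    have "orient (\<pi> x) x \<in> F" using that F_def by auto
    then have "fst (orient (\<pi> x) x) \<in> Y" "snd (orient (\<pi> x) x) \<in> Y"
      unfolding Y_def touched_def by auto
    then show ?thesis unfolding orient_def by (auto split: if_splits)
  qed
  then have XY: "X \<subseteq> Y" by auto
  have QY: "Q \<subseteq> Y" unfolding Y_def touched_def by auto
  define Es where "Es = E \<inter> Y \<times> Y - F"
  \<comment> \<open>Each surplus edge counts once per direction, whence the factor 2 in the
    bound.\<close>
  define Dir where "Dir = {(y, z). y \<in> Y \<and> z \<in> Y \<and> sym_adj E y z \<and> orient y z \<notin> F}"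
  have finEs: "finite Es" unfolding Es_def using finite_E by auto
  have "(y, z) \<in> Es \<union> prod.swap ` Es" if "(y, z) \<in> Dir" for y z
  proof -
    have yz: "y \<in> Y" "z \<in> Y" "orient y z \<in> E" "orient y z \<notin> F"
      using that orient_in_E unfolding Dir_def by auto
    then have "orient y z \<in> Es" unfolding Es_def orient_def by (auto split: if_splits)
    then show ?thesis unfolding orient_def by (auto split: if_splits)
  qed
  then have sub: "Dir \<subseteq> Es \<union> prod.swap ` Es" by (intro subrelI)
  have finDir: "finite Dir" using finite_subset[OF sub] finEs by blast
  have "card Dir \<le> card Es + card (prod.swap ` Es)"
    using card_mono[OF _ sub] finEs card_Un_le[of Es "prod.swap ` Es"] by fastforce
  also have "\<dots> \<le> 2 * card Es" using card_image_le[OF finEs, of prod.swap] by simp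
  also have "card Es \<le> k * card Q"
    using sparse Q F_inc cardF unfolding locally_sparse_def Es_def Y_def by (meson less_imp_le)
  finally have cardDir: "card Dir \<le> 2 * k * card Q" by simp
  \<comment> \<open>\<open>\<psi>\<close> recovers a clashing pair from an end of an edge outside \<open>F\<close> that it causes.\<close>
  define \<psi> where "\<psi> = (\<lambda>(y, z). if y \<in> Q then (if z \<in> Q then (z, y) else (y, z)) else (\<pi> y, y))"
  have "(SIGMA v:Q. clashes (sym_adj E) nb Q v) \<subseteq> \<psi> ` Dir"
  proof
    fix a assume "a \<in> (SIGMA v:Q. clashes (sym_adj E) nb Q v)"
    then obtain v w where a: "a = (v, w)" and v: "v \<in> Q" and vw_clash: "w \<in> clashes (sym_adj E) nb Q v"
      by blast
    have w: "w \<in> nb v" using vw_clash unfolding clashes_def by simp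
    have "\<exists>u\<in>Q - {v}. w = u \<or> sym_adj E w u \<or> (\<exists>w'\<in>nb u - {v}. sym_adj E w w')"
      using vw_clash unfolding clashes_def mem_Collect_eq by (rule conjunct2)
    then obtain u where u0: "u \<in> Q - {v}"
      and cl: "w = u \<or> sym_adj E w u \<or> (\<exists>w'\<in>nb u - {v}. sym_adj E w w')"
      by (rule bexE)
    have u: "u \<in> Q" "u \<noteq> v" using u0 by simp_all
    have vw: "sym_adj E v w" using nb_adj[OF v w] .
    then have wv: "sym_adj E w v" by (rule sym_adj_sym)
    show "a \<in> \<psi> ` Dir"
    proof (cases "w \<in> Q")
      case True
      \<comment> \<open>Every edge of \<open>F\<close> has an end in \<open>X\<close>, hence outside
        \<open>Q\<close>.\<close>
      have "orient w v \<notin> F"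
      proof
        assume "orient w v \<in> F"
        then obtain x where x: "x \<in> X" "{w, v} = {\<pi> x, x}" using F_iff by blast
        then have "x \<in> {w, v}" by simp
        then show False using x(1) True v X_def by auto
      qed
      then have "(w, v) \<in> Dir" using True v wv QY unfolding Dir_def by auto
      moreover have "a = \<psi> (w, v)" using a True v unfolding \<psi>_def by simp
      ultimately show ?thesis by blast
    next
      case False
      then have wX: "w \<in> X" using v w X_def by blast
      show ?thesis
      proof (cases "v = \<pi> w")
        case v_ne: False
        \<comment> \<open>The only edge of \<open>F\<close> between \<open>w\<close> and
          \<open>Q\<close> goes to its parent, which is not \<open>v\<close>.\<close>
        have "orient v w \<notin> F"
        proof
          assume "orient v w \<in> F"
          then obtain x where "x \<in> X" "{v, w} = {\<pi> x, x}" using F_iff by blast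
          then show False using v v_ne X_def by (auto simp: doubleton_eq_iff)
        qed
        then have "(v, w) \<in> Dir" using v vw QY XY wX unfolding Dir_def by auto
        moreover have "a = \<psi> (v, w)" using a False v unfolding \<psi>_def by simp
        ultimately show ?thesis by blast
      next
        case v_eq: True
        \<comment> \<open>When \<open>v\<close> is the parent of \<open>w\<close>, the edge
          \<open>v w\<close> lies in \<open>F\<close>, so the pair is charged to the edge from
          \<open>w\<close> to the cause \<open>z\<close> of the clash.\<close>
        have notF: "orient w z \<notin> F" if "z \<noteq> v" for z
        proof
          assume "orient w z \<in> F"
          then obtain x where x: "x \<in> X" "{w, z} = {\<pi> x, x}" using F_iff by blast
          then have "w = x" using \<pi>[OF x(1)] False by (auto simp: doubleton_eq_iff)
          then show False using x v_eq that \<pi>[OF x(1)] False by (auto simp: doubleton_eq_iff)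
        qed
        obtain z where z: "z \<noteq> v" "z \<in> Y" "sym_adj E w z"
        proof -
          from cl consider "sym_adj E w u" | w' where "w' \<in> nb u" "w' \<noteq> v" "sym_adj E w w'"
            using False u by blast
          then show thesis
          proof cases
            case 1
            then show thesis using that[of u] u QY by blast
          next
            case 2
            then have "w' \<in> X \<union> Q" using u X_def by blast
            then show thesis using that[of w'] 2 XY QY by blast
          qed
        qed
        then have "(w, z) \<in> Dir" using notF[of z] XY wX unfolding Dir_def by auto
        moreover have "a = \<psi> (w, z)" using a False v_eq unfolding \<psi>_def by simp
        ultimately show ?thesis by blast
      qed
    qed
  qed
  then have "card (SIGMA v:Q. clashes (sym_adj E) nb Q v) \<le> card Dir"
    using finDir by (meson card_image_le card_mono finite_imageI le_trans)
  moreover have "card (SIGMA v:Q. clashes (sym_adj E) nb Q v) =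
      (\<Sum>v\<in>Q. card (clashes (sym_adj E) nb Q v))"
    using Q nb unfolding clashes_def by (intro card_SigmaI) auto
  ultimately show ?thesis using cardDir by simp
qed

section \<open>The Ramsey property of locally sparse hosts\<close>

lemma min_degree_subgraph:
  assumes E': "E' \<subseteq> E" and s: "s > 0" "s * card (L \<union> B) \<le> card E'" and ne: "L \<union> B \<noteq> {}"
  shows "\<exists>U. U \<subseteq> L \<union> B \<and> U \<noteq> {} \<and> (\<forall>v\<in>U. s \<le> card {w \<in> U. sym_adj E' v w})"
proof -
  let ?e = "\<lambda>U. E' \<inter> U \<times> U"
  let ?P = "\<lambda>U. U \<subseteq> L \<union> B \<and> U \<noteq> {} \<and> s * card U \<le> card (?e U)"
  have "?e (L \<union> B) = E'" using E' E_subset by auto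
  then have "?P (L \<union> B)" using s ne by auto
  \<comment> \<open>In a smallest nonempty set of this density, deleting a vertex of degree below
    \<open>s\<close> would preserve the density.\<close>
  then have "\<exists>U. ?P U \<and> (\<forall>U'. ?P U' \<longrightarrow> card U \<le> card U')"
    by (rule ex_has_least_nat)
  then obtain U where U: "?P U" and min: "\<And>U'. ?P U' \<Longrightarrow> card U \<le> card U'"
    by blast
  have finU: "finite U" using U finite_L finite_B finite_subset by blast
  have finE': "finite E'" using E' finite_E finite_subset by blast
  have "s \<le> card {w \<in> U. sym_adj E' v w}" if v: "v \<in> U" for v
  proof (rule ccontr)
    assume less: "\<not> ?thesis"
    let ?W = "{w \<in> U. sym_adj E' v w}"
    have "?e U \<subseteq> ?e (U - {v}) \<union> orient v ` ?W"
    proof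
      fix p assume p: "p \<in> ?e U"
      obtain a b where ab: "p = (a, b)" by (cases p)
      have lr: "a \<in> L" "b \<notin> L" using p ab E' E_subset disjoint by auto
      have "(a, b) = orient v b" if "a = v" using that lr unfolding orient_def by simp
      moreover have "(a, b) = orient v a" if "b = v" using that lr unfolding orient_def by simp
      moreover have "b \<in> ?W" if "a = v" using that p ab unfolding sym_adj_def by auto
      moreover have "a \<in> ?W" if "b = v" using that p ab unfolding sym_adj_def by auto
      ultimately show "p \<in> ?e (U - {v}) \<union> orient v ` ?W"
        using p ab by blast
    qed
    then have "card (?e U) \<le> card (?e (U - {v}) \<union> orient v ` ?W)"
      using finE' finU by (intro card_mono) auto
    also have "\<dots> \<le> card (?e (U - {v})) + card (orient v ` ?W)" by (rule card_Un_le)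
    also have "card (orient v ` ?W) \<le> card ?W" using finU by (intro card_image_le) auto
    finally have "card (?e U) \<le> card (?e (U - {v})) + card ?W" by simp
    then have lt: "s * card U < card (?e (U - {v})) + s" using U less by linarith
    have cU: "card U = Suc (card (U - {v}))" using v finU by (metis card_Suc_Diff1)
    then have le: "s * card (U - {v}) < card (?e (U - {v}))" using lt by simp
    \<comment> \<open>The strict inequality rules out the empty set, which spans no edge.\<close>
    have "U - {v} \<noteq> {}"
    proof
      assume e: "U - {v} = {}"
      show False using le unfolding e by simp
    qed
    then have "?P (U - {v})" using U le by auto
    from min[OF this] show False using cU by simp
  qed
  then show ?thesis using U by blast
qed

text \<open>One colour has at least half of the edges, hence a subgraph of minimum degree
  8\<open>k\<close>. Children are taken in that colour, but clashes refer to all of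
  \<open>E\<close>, so the copy is induced in the host.\<close>

theorem induced_ramsey_host:
  fixes T :: "'a set \<times> 'a set set"
  assumes T: "tree T" "max_degree_le T (2 * k)" and k: "k > 0"
    and sparse: "locally_sparse (L \<union> B) E (8 * k) k (2 * card (fst T) + 1)"
    and edges: "16 * k * card (L \<union> B) \<le> card E" and ne: "L \<union> B \<noteq> {}"
  shows "induced_ramsey (host (L \<union> B) E) T"
  unfolding induced_ramsey_def
proof
  fix c :: "'b set \<Rightarrow> bool"
  let ?A = "sym_adj E"
  let ?col = "\<lambda>x. {(a, b) \<in> E. c {a, b} = x}"
  have "?col True \<union> ?col False = E" by auto
  then have "card E \<le> card (?col True) + card (?col False)"
    using card_Un_le[of "?col True" "?col False"] by simp
  then have "8 * k * card (L \<union> B) \<le> card (?col True) \<or> 8 * k * card (L \<union> B) \<le> card (?col False)"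
    using edges by linarith
  then obtain x where x: "8 * k * card (L \<union> B) \<le> card (?col x)" by blast
  have "\<exists>U. U \<subseteq> L \<union> B \<and> U \<noteq> {} \<and> (\<forall>v\<in>U. 8 * k \<le> card {w \<in> U. sym_adj (?col x) v w})"
    by (rule min_degree_subgraph) (use k ne x in auto)
  then obtain U where U: "U \<subseteq> L \<union> B" "U \<noteq> {}"
      "\<And>v. v \<in> U \<Longrightarrow> 8 * k \<le> card {w \<in> U. sym_adj (?col x) v w}"
    by blast
  have "\<forall>v\<in>U. \<exists>S. S \<subseteq> {w \<in> U. sym_adj (?col x) v w} \<and> card S = 8 * k"
    by (intro ballI, rule obtain_subset_with_card_n[OF U(3)]) blast+
  from bchoice[OF this] obtain nb where
    nb: "\<And>v. v \<in> U \<Longrightarrow> nb v \<subseteq> {w \<in> U. sym_adj (?col x) v w}"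
      "\<And>v. v \<in> U \<Longrightarrow> card (nb v) = 8 * k"
    by blast
  have finU: "finite U" using U finite_L finite_B finite_subset by blast
  have nb_sub: "nb v \<subseteq> U" if "v \<in> U" for v using nb(1)[OF that] by blast
  have nb_col: "sym_adj (?col x) v w" if "v \<in> U" "w \<in> nb v" for v w
    using nb(1)[OF that(1)] that(2) by blast
  have nb_adj: "?A v w" if "v \<in> U" "w \<in> nb v" for v w
    using nb_col[OF that] unfolding sym_adj_def by auto
  have nb_c: "c {v, w} = x" if "v \<in> U" "w \<in> nb v" for v w
    using nb_col[OF that] unfolding sym_adj_def by (auto simp: insert_commute)
  interpret H: sparse_host ?A U nb "2 * k" "card (fst T)"
  proof
    fix Q assume Q: "Q \<subseteq> U" "Q \<noteq> {}" "card Q \<le> 2 * card (fst T) + 1"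
    show "(\<Sum>v\<in>Q. card (clashes ?A nb Q v)) \<le> 2 * k * card Q"
    proof (rule sum_clashes_le[OF sparse])
      show "Q \<subseteq> L \<union> B" "Q \<noteq> {}" "card Q \<le> 2 * card (fst T) + 1" using Q U by auto
      show "finite Q" using Q finU finite_subset by blast
      show "finite (nb v) \<and> card (nb v) \<le> 8 * k" if "v \<in> Q" for v
        using that Q nb_sub[of v] nb(2)[of v] finU finite_subset by auto
      show "?A v w" if "v \<in> Q" "w \<in> nb v" for v w using that Q nb_adj by blast
    qed
  next
    fix v x y assume "?A v x" "?A v y"
    then show "\<not> ?A x y" by (rule triangle_free)
  next
    fix v assume "v \<in> U"
    then show "card (nb v) = 4 * (2 * k)" using nb(2) by simp
  next
    fix y z assume "?A y z"
    then show "?A z y" by (rule sym_adj_sym)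
  qed (use finU U(2) nb_sub nb_adj in auto)
  obtain f where f: "inj_on f (fst T)" "f ` fst T \<subseteq> U"
    "\<forall>u\<in>fst T. \<forall>v\<in>fst T. u \<noteq> v \<longrightarrow> (?A (f u) (f v) \<longleftrightarrow> adj T u v)"
    "\<forall>u\<in>fst T. \<forall>v\<in>fst T. u \<noteq> v \<longrightarrow> adj T u v \<longrightarrow> f v \<in> nb (f u) \<or> f u \<in> nb (f v)"
    using H.tree_embeds[OF T(1)] T(2) k by (metis nat_0_less_mult_iff zero_less_numeral)
  have "c (f ` e) = x" if e: "e \<in> snd T" for e
  proof -
    obtain u v where uv: "e = {u, v}" "u \<noteq> v" "u \<in> fst T" "v \<in> fst T"
      using T(1) e unfolding tree_def graph_def by blast
    then have "f v \<in> nb (f u) \<or> f u \<in> nb (f v)" using f(4) e unfolding adj_def by blast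
    moreover have "f u \<in> U" "f v \<in> U" using f(2) uv by auto
    ultimately have "c {f u, f v} = x" using nb_c by (metis insert_commute)
    then show ?thesis using uv by simp
  qed
  then show "mono_induced_copy (host (L \<union> B) E) c T"
    unfolding mono_induced_copy_def adj_host
    using f(1-3) U(1) by (intro exI[of _ f]) (auto simp: host_def)
qed

lemma graph_host: "graph (host (L \<union> B) E)"
  unfolding graph_def host_def using finite_L finite_B E_subset disjoint by fastforce

lemma num_edges_host: "num_edges (host (L \<union> B) E) \<le> card E"
  unfolding num_edges_def host_def using finite_E by (simp add: card_image_le)

end

section \<open>Estimates for the union bound\<close>

lemma sum_power_div_fact_le_exp:
  assumes "x \<ge> 0"
  shows "(\<Sum>i\<le>n. x ^ i / fact i) \<le> exp (x::real)"
proof -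
  have "(\<Sum>i\<le>n. inverse (fact i) * x ^ i) \<le> (\<Sum>i. inverse (fact i) * x ^ i)"
    using assms by (intro sum_le_suminf summable_exp) auto
  also have "\<dots> = exp x" by (simp add: exp_def divide_inverse mult.commute)
  finally show ?thesis by (simp add: divide_inverse mult.commute)
qed

lemma exp_of_nat_le: "exp (real n) \<le> 3 ^ n"
proof -
  have "exp (real n) = exp 1 ^ n" by (simp add: exp_of_nat_mult[symmetric])
  also have "\<dots> \<le> 3 ^ n" using exp_le by (intro power_mono) auto
  finally show ?thesis .
qed

text \<open>The quotient of the two powers and factorial is governed by one term of the exponential
  series at \<open>n\<close>, and e is at most 3.\<close>

lemma self_power_le_fact: "real n ^ n \<le> 3 ^ n * fact n"
proof -
  have "real n ^ n / fact n \<le> (\<Sum>i\<le>n. real n ^ i / fact i)"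
    by (rule member_le_sum) auto
  also have "\<dots> \<le> 3 ^ n"
    using sum_power_div_fact_le_exp[of "real n" n] exp_of_nat_le[of n] by simp
  finally show ?thesis by (simp add: field_simps)
qed

lemma card_subsets_le:
  assumes "finite A" "card A \<le> m"
  shows "real (card {S. S \<subseteq> A \<and> card S = k}) \<le> real m ^ k / fact k"
proof -
  have "real (card A choose k) * fact k \<le> real (card A) ^ k"
    using binomial_fact_pow[of "card A" k] by (metis of_nat_fact of_nat_le_iff of_nat_mult of_nat_power)
  also have "\<dots> \<le> real m ^ k" using assms by (intro power_mono) auto
  finally show ?thesis using n_subsets[OF assms(1), of k] by (simp add: field_simps)
qed

lemma card_Sigma_le:
  assumes "finite A" "\<And>a. a \<in> A \<Longrightarrow> finite (B a)" "\<And>a. a \<in> A \<Longrightarrow> real (card (B a)) \<le> b"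
    "real (card A) \<le> c" "b \<ge> 0"
  shows "real (card (Sigma A B)) \<le> c * b"
proof -
  have "real (card (Sigma A B)) = (\<Sum>a\<in>A. real (card (B a)))"
    using assms by (simp add: card_SigmaI)
  also have "\<dots> \<le> real (card A) * b" using assms by (intro sum_bounded_above) auto
  also have "\<dots> \<le> c * b" using assms by (intro mult_right_mono) auto
  finally show ?thesis .
qed

lemma sum_quarter_powers: "(\<Sum>q = 1..m. (1/4::real) ^ q) = (1 - (1/4) ^ m) / 3"
proof (induction m)
  case (Suc m)
  have "(\<Sum>q = 1..Suc m. (1/4::real) ^ q) = (1 - (1/4) ^ m) / 3 + (1/4) * (1/4) ^ m"
    using Suc by simp
  also have "\<dots> = (1 - (1/4) ^ Suc m) / 3"
    unfolding power_Suc by argo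
  finally show ?case .
qed simp

text \<open>Here \<open>t\<close> stands for \<open>q / n\<close>. One of the \<open>k\<close> small
  factors cancels \<open>1 / t\<close>; the at least nine others outweigh the constant and
  \<open>k\<close> squared, which is at most 4 to the power \<open>k\<close>.\<close>

lemma tail_base_le:
  fixes t :: real and k :: nat
  assumes "0 < t" "t \<le> 3" "k \<ge> 10"
  shows "192 * (2 * 10 ^ 19) * real k ^ 2 / t * (2 * t / 10 ^ 8) ^ k \<le> 1 / 4"
proof -
  obtain j where k: "k = Suc j" "j \<ge> 9" using assms(3) by (cases k) auto
  have "k < 2 ^ k" by (rule less_exp)
  then have "real k < 2 ^ k" by (metis of_nat_less_iff of_nat_numeral of_nat_power)
  then have "real k ^ 2 \<le> (2 ^ k) ^ 2" by (intro power_mono) auto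
  moreover have "((2::real) ^ k) ^ 2 = (2 ^ 2) ^ k" by (metis power_mult mult.commute)
  ultimately have k2: "real k ^ 2 \<le> 4 * 4 ^ j" using k by simp
  have "192 * (2 * 10 ^ 19) * real k ^ 2 / t * (2 * t / 10 ^ 8) ^ k =
      192 * 4 * 10 ^ 11 * real k ^ 2 * (2 * t / 10 ^ 8) ^ j"
    using assms unfolding k by (simp add: field_simps)
  also have "\<dots> \<le> 192 * 4 * 10 ^ 11 * (4 * 4 ^ j) * (1 / 10 ^ 7) ^ j"
    using assms k2 by (intro mult_mono power_mono) auto
  also have "\<dots> = 192 * 4 * 10 ^ 11 * 4 * (4 * (1 / 10 ^ 7)) ^ j"
    unfolding power_mult_distrib by (simp only: mult.assoc)
  also have "\<dots> \<le> 192 * 4 * 10 ^ 11 * 4 * (4 * (1 / 10 ^ 7)) ^ 9"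
    using k by (intro mult_left_mono power_decreasing) auto
  also have "\<dots> \<le> 1 / 4" by (simp add: power_divide)
  finally show ?thesis .
qed

text \<open>The left side bounds the expected number of bad configurations with \<open>q\<close>
  vertices: ways to choose the set, the forest of \<open>x\<close> edges and the surplus edges,
  times the probability that all these edges occur.\<close>

lemma union_bound_term:
  fixes n k q M N :: nat
  assumes "k \<ge> 10" "q \<ge> 1" "q \<le> 3 * n" and M: "M = 2 * 10 ^ 19 * k * n" and N: "N = 32 * k * M"
  shows "(\<Sum>x\<le>8 * k * q. real (2 * N) ^ q / fact q * (real (q * N) ^ x / fact x) *
      (real ((q + 2 * x) ^ 2) ^ (k * q) / fact (k * q)) / real M ^ (x + k * q)) \<le> (1 / 4) ^ q"
proof -
  define K where "K = k * q"
  have n: "n > 0" using assms by (cases n) auto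
  have M0: "M > 0" using M n assms by simp
  have qK: "q \<le> K" "K > 0" using assms K_def by auto
  have term_le: "real (2 * N) ^ q / fact q * (real (q * N) ^ x / fact x) *
      (real ((q + 2 * x) ^ 2) ^ K / fact K) / real M ^ (x + K) \<le>
      real (2 * N) ^ q / fact q * (real ((17 * K) ^ 2) ^ K / fact K) / real M ^ K * 4 ^ (8 * K) *
        (real (8 * K) ^ x / fact x)"
    if x: "x \<le> 8 * K" for x
  proof -
    \<comment> \<open>The ratio is 32\<open>K\<close>. Splitting off the factor 4 leaves terms of
      the exponential series at 8\<open>K\<close>, so that the sum over \<open>x\<close> is
      harmless.\<close>
    have "real (q * N) / real M = 4 * real (8 * K)"
      using M0 unfolding N K_def by simp
    then have "real (q * N) ^ x / real M ^ x = (4 * real (8 * K)) ^ x"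
      by (simp only: power_divide[symmetric])
    also have "\<dots> = 4 ^ x * real (8 * K) ^ x" by (rule power_mult_distrib)
    also have "\<dots> \<le> 4 ^ (8 * K) * real (8 * K) ^ x"
      using x by (intro mult_right_mono power_increasing) auto
    finally have 1: "real (q * N) ^ x / real M ^ x \<le> 4 ^ (8 * K) * real (8 * K) ^ x" .
    have "q + 2 * x \<le> 17 * K" using x qK by auto
    then have 2: "real ((q + 2 * x) ^ 2) ^ K \<le> real ((17 * K) ^ 2) ^ K"
      by (intro power_mono of_nat_mono) auto
    have "real (2 * N) ^ q / fact q * (real (q * N) ^ x / fact x) *
      (real ((q + 2 * x) ^ 2) ^ K / fact K) / real M ^ (x + K) =
      (real (q * N) ^ x / real M ^ x) * real ((q + 2 * x) ^ 2) ^ K *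
        (real (2 * N) ^ q / fact q / fact x / fact K / real M ^ K)"
      by (simp add: power_add field_simps)
    also have "\<dots> \<le> (4 ^ (8 * K) * real (8 * K) ^ x) * real ((17 * K) ^ 2) ^ K *
        (real (2 * N) ^ q / fact q / fact x / fact K / real M ^ K)"
      by (intro mult_right_mono mult_mono 1 2) auto
    also have "\<dots> = real (2 * N) ^ q / fact q * (real ((17 * K) ^ 2) ^ K / fact K) / real M ^ K *
        4 ^ (8 * K) * (real (8 * K) ^ x / fact x)"
      by (simp add: field_simps)
    finally show ?thesis .
  qed
  have "(\<Sum>x\<le>8 * K. real (2 * N) ^ q / fact q * (real (q * N) ^ x / fact x) *
      (real ((q + 2 * x) ^ 2) ^ K / fact K) / real M ^ (x + K)) \<le>
    (\<Sum>x\<le>8 * K. real (2 * N) ^ q / fact q * (real ((17 * K) ^ 2) ^ K / fact K) / real M ^ K *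
        4 ^ (8 * K) * (real (8 * K) ^ x / fact x))"
    by (intro sum_mono term_le) auto
  also have "\<dots> = real (2 * N) ^ q / fact q * (real ((17 * K) ^ 2) ^ K / fact K) / real M ^ K *
        4 ^ (8 * K) * (\<Sum>x\<le>8 * K. real (8 * K) ^ x / fact x)"
    by (rule sum_distrib_left[symmetric])
  also have "\<dots> \<le> real (2 * N) ^ q / fact q * (real ((17 * K) ^ 2) ^ K / fact K) / real M ^ K *
        4 ^ (8 * K) * 3 ^ (8 * K)"
    using sum_power_div_fact_le_exp[of "real (8 * K)" "8 * K"] exp_of_nat_le[of "8 * K"]
    by (intro mult_left_mono) auto
  also have "\<dots> = (real (2 * N) ^ q / fact q) *
      ((real K ^ K / fact K) * (289 * real K * 4 ^ 8 * 3 ^ 8 / real M) ^ K)"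
  proof -
    \<comment> \<open>One power of \<open>K\<close> will be absorbed by the factorial, the other by
      the power of \<open>M\<close>.\<close>
    have "real ((17 * K) ^ 2) = 289 * real K * real K" by (simp add: power2_eq_square)
    then have 1: "real ((17 * K) ^ 2) ^ K = 289 ^ K * real K ^ K * real K ^ K"
      by (simp only: power_mult_distrib)
    have 2: "(289 * real K * 4 ^ 8 * 3 ^ 8 / real M) ^ K =
        289 ^ K * real K ^ K * 4 ^ (8 * K) * 3 ^ (8 * K) / real M ^ K"
      by (simp only: power_divide power_mult_distrib power_mult)
    show ?thesis unfolding 1 2 by (simp add: mult_ac)
  qed
  also have "\<dots> \<le> (6 * real N / real q) ^ q *
      (3 ^ K * (289 * real K * 4 ^ 8 * 3 ^ 8 / real M) ^ K)"
  proof (intro mult_mono)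
    have "real (2 * N) ^ q * real q ^ q \<le> real (2 * N) ^ q * (3 ^ q * fact q)"
      using self_power_le_fact[of q] by (intro mult_left_mono) auto
    then have "real (2 * N) ^ q / fact q \<le> real (2 * N) ^ q * 3 ^ q / real q ^ q"
      using assms(2) by (simp add: field_simps)
    also have "\<dots> = (real (2 * N) * 3 / real q) ^ q"
      by (simp only: power_divide power_mult_distrib)
    also have "real (2 * N) * 3 / real q = 6 * real N / real q" by simp
    finally show "real (2 * N) ^ q / fact q \<le> (6 * real N / real q) ^ q" .
    show "real K ^ K / fact K \<le> 3 ^ K"
      using self_power_le_fact[of K] by (simp add: field_simps)
  qed auto
  also have "\<dots> = (192 * (2 * 10 ^ 19) * real k ^ 2 / (real q / real n)) ^ q *
      (289 * 4 ^ 8 * 3 ^ 9 * ((real q / real n) / (2 * 10 ^ 19))) ^ K"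
  proof -
    have "real K / real M = (real q / real n) / (2 * 10 ^ 19)"
      using n assms unfolding K_def M by (simp add: field_simps)
    then have "289 * 4 ^ 8 * 3 ^ 9 * ((real q / real n) / (2 * 10 ^ 19)) =
        3 * (289 * real K * 4 ^ 8 * 3 ^ 8 / real M)"
      by simp
    then have 1: "(289 * 4 ^ 8 * 3 ^ 9 * ((real q / real n) / (2 * 10 ^ 19))) ^ K =
        3 ^ K * (289 * real K * 4 ^ 8 * 3 ^ 8 / real M) ^ K" by (simp only: power_mult_distrib)
    have 2: "6 * real N / real q = 192 * (2 * 10 ^ 19) * real k ^ 2 / (real q / real n)"
      using n assms unfolding N M by (simp add: field_simps power2_eq_square)
    show ?thesis by (simp only: 1 2)
  qed
  also have "\<dots> \<le>
      (192 * (2 * 10 ^ 19) * real k ^ 2 / (real q / real n)) ^ q *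
      (2 * (real q / real n) / 10 ^ 8) ^ K"
  proof (intro mult_left_mono power_mono)
    \<comment> \<open>The constant on the left is about 1.87 * 10^(-8).\<close>
    have "289 * 4 ^ 8 * 3 ^ 9 * (t / (2 * 10 ^ 19)) \<le> 2 * t / 10 ^ 8" if "t \<ge> 0" for t :: real
      using that by simp
    then show "289 * 4 ^ 8 * 3 ^ 9 * ((real q / real n) / (2 * 10 ^ 19)) \<le> 2 * (real q / real n) / 10 ^ 8"
      by (metis divide_nonneg_nonneg of_nat_0_le_iff)
  qed auto
  also have "\<dots> = (192 * (2 * 10 ^ 19) * real k ^ 2 / (real q / real n) *
      (2 * (real q / real n) / 10 ^ 8) ^ k) ^ q"
    by (simp only: K_def power_mult power_mult_distrib)
  also have "\<dots> \<le> (1 / 4) ^ q"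
  proof (intro power_mono tail_base_le)
    show "real q / real n \<le> 3" using assms n
      by (simp add: field_simps)
  qed (use assms n in auto)
  finally show ?thesis unfolding K_def by (simp add: mult.assoc)
qed

section \<open>The random host\<close>

text \<open>Every left vertex picks one neighbour in each of \<open>d\<close> blocks of \<open>M\<close> right vertices; this makes the
  number of edges deterministic, and \<open>t\<close> given pairs are all edges with probability at most \<open>M\<close> to
  the power \<open>-t\<close>.\<close>

locale random_host =
  fixes M d N :: nat
  assumes M_pos: "M > 0" and N_eq: "N = d * M"
begin

abbreviation left :: "nat set" where "left \<equiv> {..<N}"
abbreviation right :: "nat set" where "right \<equiv> {N..<2 * N}"

definition slots :: "(nat \<times> nat) set" where
  "slots = {..<N} \<times> {..<d}"

definition block :: "nat \<Rightarrow> nat set" where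
  "block j = {N + j * M..<N + j * M + M}"

text \<open>The uniform sample space; probabilities are expressed by counting its elements.\<close>

definition choices :: "(nat \<times> nat \<Rightarrow> nat) set" where
  "choices = (\<Pi>\<^sub>E i\<in>slots. block (snd i))"

definition pairs :: "(nat \<times> nat \<Rightarrow> nat) \<Rightarrow> (nat \<times> nat) set" where
  "pairs g = (\<lambda>i. (fst i, g i)) ` slots"

text \<open>The only slot that can produce a given pair: blocks are disjoint, and division recovers
  the block index.\<close>

definition slot :: "nat \<times> nat \<Rightarrow> nat \<times> nat" where
  "slot p = (fst p, (snd p - N) div M)"

lemma finite_slots: "finite slots" and card_slots: "card slots = N * d"
  unfolding slots_def by auto

lemma card_block: "card (block j) = M"
  unfolding block_def by simp

lemma finite_choices: "finite choices"
  unfolding choices_def block_def using finite_slots by (intro finite_PiE) auto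

lemma card_choices: "card choices = M ^ (N * d)"
  unfolding choices_def using finite_slots card_slots by (simp add: card_PiE card_block)

lemma block_div: "b \<in> block j \<Longrightarrow> (b - N) div M = j"
  unfolding block_def by (intro div_nat_eqI) (auto simp: mult.commute)

lemma block_subset:
  assumes "j < d"
  shows "block j \<subseteq> right"
proof -
  have "Suc j * M \<le> N" unfolding N_eq using assms by (intro mult_le_mono1) auto
  then show ?thesis unfolding block_def by auto
qed

lemma choice_in_block: "g \<in> choices \<Longrightarrow> i \<in> slots \<Longrightarrow> g i \<in> block (snd i)"
  unfolding choices_def by (rule PiE_mem)

lemma slot_chosen:
  assumes "g \<in> choices" "p \<in> pairs g"
  shows "g (slot p) = snd p"
proof -
  obtain i where i: "i \<in> slots" "p = (fst i, g i)" using assms unfolding pairs_def by blast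
  then have "g i \<in> block (snd i)" using assms choice_in_block by blast
  then have "slot p = i" unfolding slot_def i(2) by (simp add: block_div)
  then show ?thesis using i by simp
qed

lemma pairs_bipartite:
  assumes "g \<in> choices"
  shows "bipartite left right (pairs g)"
proof
  show "pairs g \<subseteq> left \<times> right"
  proof
    fix p assume "p \<in> pairs g"
    then obtain i where i: "i \<in> slots" "p = (fst i, g i)" unfolding pairs_def by blast
    then have lt: "fst i < N" "snd i < d" unfolding slots_def by auto
    then have "g i \<in> right" using choice_in_block[OF assms i(1)] block_subset by blast
    then show "p \<in> left \<times> right" using i lt by simp
  qed
qed auto

lemma card_pairs:
  assumes "g \<in> choices"
  shows "card (pairs g) = N * d"
proof -
  have "inj_on (\<lambda>i. (fst i, g i)) slots"
  proof (rule inj_onI)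
    fix i i' assume i: "i \<in> slots" "i' \<in> slots" "(fst i, g i) = (fst i', g i')"
    then have "g i \<in> block (snd i)" "g i' \<in> block (snd i')"
      using assms choice_in_block by blast+
    then have "snd i = snd i'" using i(3) block_div by (metis Pair_inject)
    then show "i = i'" using i(3) by (simp add: prod_eq_iff)
  qed
  then show ?thesis unfolding pairs_def using card_slots by (simp add: card_image)
qed

text \<open>If any choice contains \<open>P\<close>, its pairs occupy distinct slots and force the
  value in each of them; only the other slots remain free.\<close>

lemma card_choices_containing:
  assumes P: "P \<subseteq> left \<times> right"
  shows "card {g \<in> choices. P \<subseteq> pairs g} * M ^ card P \<le> M ^ (N * d)"
proof (cases "{g \<in> choices. P \<subseteq> pairs g} = {}")
  case False
  then obtain g0 where g0: "g0 \<in> choices" "P \<subseteq> pairs g0" by blast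
  let ?J = "slot ` P"
  have inj: "inj_on slot P"
  proof (rule inj_onI)
    fix p p' assume p: "p \<in> P" "p' \<in> P" "slot p = slot p'"
    then have "snd p = snd p'" using slot_chosen[OF g0(1)] g0(2) by (metis subsetD)
    then show "p = p'" using p(3) unfolding slot_def by (simp add: prod_eq_iff)
  qed
  have J: "?J \<subseteq> slots"
  proof
    fix i assume "i \<in> ?J"
    then obtain a b where ab: "i = slot (a, b)" "(a, b) \<in> P" by auto
    then have "a < N" "b < 2 * N" using P by auto
    moreover from this have "(b - N) div M < d" using N_eq by (intro less_mult_imp_div_less) linarith
    ultimately show "i \<in> slots" using ab unfolding slots_def slot_def by simp
  qed
  let ?C = "\<lambda>i. if i \<in> ?J then {g0 i} else block (snd i)"
  have "{g \<in> choices. P \<subseteq> pairs g} \<subseteq> Pi\<^sub>E slots ?C"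
  proof
    fix g assume "g \<in> {g \<in> choices. P \<subseteq> pairs g}"
    then have g: "g \<in> choices" "P \<subseteq> pairs g" by auto
    have "g (slot p) = g0 (slot p)" if "p \<in> P" for p
      using that slot_chosen g g0 by (metis subsetD)
    then show "g \<in> Pi\<^sub>E slots ?C" using g(1) unfolding choices_def PiE_def Pi_def by auto
  qed
  then have "card {g \<in> choices. P \<subseteq> pairs g} \<le> card (Pi\<^sub>E slots ?C)"
    using finite_slots by (intro card_mono finite_PiE) (auto simp: block_def)
  also have "\<dots> = (\<Prod>i\<in>slots. if i \<in> ?J then 1 else M)"
    using finite_slots by (simp add: card_PiE) (intro prod.cong, auto simp: card_block)
  also have "\<dots> = M ^ card (slots - ?J)"
    using finite_slots by (simp add: prod.If_cases Diff_eq)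
  finally have "card {g \<in> choices. P \<subseteq> pairs g} * M ^ card P \<le> M ^ card (slots - ?J) * M ^ card ?J"
    using inj by (simp add: card_image)
  also have "\<dots> = M ^ (N * d)"
    using J finite_slots card_slots
    by (metis card_Diff_subset card_mono finite_subset le_add_diff_inverse2 power_add)
  finally show ?thesis .
next
  case True
  then show ?thesis by (simp only: card.empty)
qed

section \<open>Counting witnesses against local sparseness\<close>

definition configs :: "nat \<Rightarrow> nat \<Rightarrow> nat \<Rightarrow> (nat set \<times> (nat \<times> nat) set \<times> (nat \<times> nat) set) set" where
  "configs k q x = (SIGMA Q:{Q. Q \<subseteq> left \<union> right \<and> card Q = q}.
     SIGMA F:{F. F \<subseteq> incident (left \<times> right) Q \<and> card F = x}.
       {S. S \<subseteq> left \<times> right \<inter> touched Q F \<times> touched Q F - F \<and> card S = k * q})"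

lemma card_incident:
  assumes "finite Q"
  shows "card (incident (left \<times> right) Q) \<le> card Q * N"
proof -
  have "incident (left \<times> right) Q \<subseteq> (\<Union>v\<in>Q. if v < N then {v} \<times> right else left \<times> {v})"
    unfolding incident_def by (auto split: if_splits)
  then have "card (incident (left \<times> right) Q) \<le>
      card (\<Union>v\<in>Q. if v < N then {v} \<times> right else left \<times> {v})"
    using assms by (intro card_mono) auto
  also have "\<dots> \<le> (\<Sum>v\<in>Q. card (if v < N then {v} \<times> right else left \<times> {v}))"
    using assms by (rule card_UN_le)
  also have "\<dots> \<le> (\<Sum>v\<in>Q. N)" by (intro sum_mono) auto
  finally show ?thesis by simp
qed

lemma card_touched:
  assumes "finite Q" "finite F"
  shows "finite (touched Q F)" "card (touched Q F) \<le> card Q + 2 * card F"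
proof -
  show "finite (touched Q F)" using assms unfolding touched_def by auto
  have "card (touched Q F) \<le> card Q + card (fst ` F) + card (snd ` F)"
    unfolding touched_def by (meson card_Un_le le_trans add_le_mono1)
  then show "card (touched Q F) \<le> card Q + 2 * card F"
    using card_image_le[OF assms(2), of fst] card_image_le[OF assms(2), of snd] by linarith
qed

lemma finite_incident: "finite (incident (left \<times> right) Q)"
  by (rule finite_subset[of _ "left \<times> right"]) (auto simp: incident_def)

lemma finite_configs: "finite (configs k q x)"
  unfolding configs_def using finite_incident
  by (intro finite_SigmaI finite_Collect_conjI disjI1) (auto intro: finite_Diff)

lemma card_configs:
  "real (card (configs k q x)) \<le> real (2 * N) ^ q / fact q * (real (q * N) ^ x / fact x *
     (real ((q + 2 * x) ^ 2) ^ (k * q) / fact (k * q)))"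
  unfolding configs_def
proof (intro card_Sigma_le)
  have V: "left \<union> right = {..<2 * N}" by auto
  show "finite {Q. Q \<subseteq> left \<union> right \<and> card Q = q}" by simp
  show "real (card {Q. Q \<subseteq> left \<union> right \<and> card Q = q}) \<le> real (2 * N) ^ q / fact q"
    unfolding V by (rule card_subsets_le) auto
  fix Q assume Q: "Q \<in> {Q. Q \<subseteq> left \<union> right \<and> card Q = q}"
  then have finQ: "finite Q" by (auto intro: finite_subset)
  show "finite {F. F \<subseteq> incident (left \<times> right) Q \<and> card F = x}" using finite_incident by simp
  show "real (card {F. F \<subseteq> incident (left \<times> right) Q \<and> card F = x}) \<le> real (q * N) ^ x / fact x"
    using card_incident[OF finQ] Q finite_incident by (intro card_subsets_le) auto
  fix F assume F: "F \<in> {F. F \<subseteq> incident (left \<times> right) Q \<and> card F = x}"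
  let ?Y = "touched Q F"
  let ?S = "left \<times> right \<inter> ?Y \<times> ?Y - F"
  have finF: "finite F" using F finite_incident finite_subset by blast
  have finY: "finite ?Y" "card ?Y \<le> q + 2 * x" using card_touched[OF finQ finF] Q F by auto
  have finS: "finite ?S" using finY by auto
  show "finite {S. S \<subseteq> ?S \<and> card S = k * q}" using finS by simp
  have "card ?S \<le> card (?Y \<times> ?Y)" using finY by (intro card_mono) auto
  also have "\<dots> \<le> (q + 2 * x) ^ 2"
    using finY by (simp add: card_cartesian_product power2_eq_square mult_le_mono)
  finally show "real (card {S. S \<subseteq> ?S \<and> card S = k * q}) \<le>
      real ((q + 2 * x) ^ 2) ^ (k * q) / fact (k * q)"
    using finS by (intro card_subsets_le) auto
qed (auto intro!: finite_SigmaI finite_Collect_conjI finite_incident)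

text \<open>The surplus is trimmed to exactly \<open>k * card Q\<close> edges, and the witness lives
  in the complete bipartite graph, so it can be counted independently of \<open>g\<close>.\<close>

lemma not_sparse_config:
  assumes g: "g \<in> choices" and ns: "\<not> locally_sparse (left \<union> right) (pairs g) (8 * k) k m"
  shows "\<exists>q\<in>{1..m}. \<exists>x\<le>8 * k * q. \<exists>(Q, F, S)\<in>configs k q x. F \<union> S \<subseteq> pairs g"
proof -
  interpret bipartite left right "pairs g" by (rule pairs_bipartite[OF g])
  obtain Q F where Q: "Q \<subseteq> left \<union> right" "Q \<noteq> {}" "card Q \<le> m"
    and F: "F \<subseteq> incident (pairs g) Q" "card F \<le> 8 * k * card Q"
    and big: "k * card Q \<le> card (pairs g \<inter> touched Q F \<times> touched Q F - F)"
    using ns unfolding locally_sparse_def by (auto simp: not_less)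
  obtain S where S: "S \<subseteq> pairs g \<inter> touched Q F \<times> touched Q F - F" "card S = k * card Q"
    using obtain_subset_with_card_n[OF big] by blast
  have "finite Q" using Q(1) by (auto intro: finite_subset)
  then have "card Q \<in> {1..m}" using Q by (simp add: Suc_le_eq card_gt_0_iff)
  moreover have "(Q, F, S) \<in> configs k (card Q) (card F)"
    using Q F S E_subset unfolding configs_def incident_def by auto
  moreover have "F \<union> S \<subseteq> pairs g" using F S unfolding incident_def by auto
  ultimately show ?thesis using F(2) by blast
qed

lemma card_config_event:
  assumes "(Q, F, S) \<in> configs k q x"
  shows "real (card {g \<in> choices. F \<union> S \<subseteq> pairs g}) \<le> real (M ^ (N * d)) / real M ^ (x + k * q)"
proof -
  have F: "F \<subseteq> left \<times> right" "card F = x" "S \<subseteq> left \<times> right - F" "card S = k * q"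
    using assms unfolding configs_def incident_def by auto
  have "finite F" "finite S" using F by (auto intro: finite_subset)
  then have "card (F \<union> S) = x + k * q" using F by (subst card_Un_disjoint) auto
  then have "card {g \<in> choices. F \<union> S \<subseteq> pairs g} * M ^ (x + k * q) \<le> M ^ (N * d)"
    using card_choices_containing[of "F \<union> S"] F by auto
  from of_nat_mono[OF this, where 'a = real]
  have "real (card {g \<in> choices. F \<union> S \<subseteq> pairs g}) * real M ^ (x + k * q) \<le> real (M ^ (N * d))"
    by (simp only: of_nat_mult of_nat_power)
  then show ?thesis using M_pos by (subst pos_le_divide_eq) simp_all
qed

text \<open>Union bound: the bad events cover at most a third of all choices.\<close>

lemma exists_sparse:
  assumes bound: "\<And>q. q \<in> {1..m} \<Longrightarrow> (\<Sum>x\<le>8 * k * q. real (2 * N) ^ q / fact q * (real (q * N) ^ x / fact x) *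
      (real ((q + 2 * x) ^ 2) ^ (k * q) / fact (k * q)) / real M ^ (x + k * q)) \<le> (1 / 4) ^ q"
  shows "\<exists>g\<in>choices. locally_sparse (left \<union> right) (pairs g) (8 * k) k m"
proof (rule ccontr)
  assume none: "\<not> ?thesis"
  let ?ev = "\<lambda>(Q, F, S). {g \<in> choices. F \<union> S \<subseteq> pairs g}"
  let ?W = "real (M ^ (N * d))"
  have "choices \<subseteq> (\<Union>q\<in>{1..m}. \<Union>x\<in>{..8 * k * q}. \<Union>c\<in>configs k q x. ?ev c)"
  proof
    fix g assume g: "g \<in> choices"
    then have "\<not> locally_sparse (left \<union> right) (pairs g) (8 * k) k m" using none by blast
    from not_sparse_config[OF g this] obtain q x Q F S where
      "q \<in> {1..m}" "x \<le> 8 * k * q" "(Q, F, S) \<in> configs k q x" "F \<union> S \<subseteq> pairs g"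
      by blast
    moreover from this have "g \<in> ?ev (Q, F, S)" using g by simp
    ultimately show "g \<in> (\<Union>q\<in>{1..m}. \<Union>x\<in>{..8 * k * q}. \<Union>c\<in>configs k q x. ?ev c)"
      by (intro UN_I[of q] UN_I[of x] UN_I[of "(Q, F, S)"]) simp_all
  qed
  then have "card choices \<le> card (\<Union>q\<in>{1..m}. \<Union>x\<in>{..8 * k * q}. \<Union>c\<in>configs k q x. ?ev c)"
    using finite_choices finite_configs by (intro card_mono finite_UN_I) auto
  also have "\<dots> \<le> (\<Sum>q = 1..m. card (\<Union>x\<in>{..8 * k * q}. \<Union>c\<in>configs k q x. ?ev c))"
    by (rule card_UN_le) simp
  also have "\<dots> \<le> (\<Sum>q = 1..m. \<Sum>x\<le>8 * k * q. card (\<Union>c\<in>configs k q x. ?ev c))"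
    by (intro sum_mono card_UN_le) simp
  also have "\<dots> \<le> (\<Sum>q = 1..m. \<Sum>x\<le>8 * k * q. \<Sum>c\<in>configs k q x. card (?ev c))"
    by (intro sum_mono card_UN_le finite_configs)
  finally have "?W \<le> real (\<Sum>q = 1..m. \<Sum>x\<le>8 * k * q. \<Sum>c\<in>configs k q x. card (?ev c))"
    unfolding card_choices by (rule of_nat_mono)
  also have "\<dots> = (\<Sum>q = 1..m. \<Sum>x\<le>8 * k * q. \<Sum>c\<in>configs k q x. real (card (?ev c)))"
    by simp
  also have "\<dots> \<le> (\<Sum>q = 1..m. ?W * (1 / 4) ^ q)"
  proof (rule sum_mono)
    fix q assume q: "q \<in> {1..m}"
    have "(\<Sum>x\<le>8 * k * q. \<Sum>c\<in>configs k q x. real (card (?ev c))) \<le>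
      (\<Sum>x\<le>8 * k * q. ?W * (real (2 * N) ^ q / fact q * (real (q * N) ^ x / fact x) *
      (real ((q + 2 * x) ^ 2) ^ (k * q) / fact (k * q)) / real M ^ (x + k * q)))"
    proof (rule sum_mono)
      fix x
      have "(\<Sum>c\<in>configs k q x. real (card (?ev c))) \<le>
          real (card (configs k q x)) * (?W / real M ^ (x + k * q))"
        using card_config_event by (intro sum_bounded_above) auto
      also have "\<dots> \<le> (real (2 * N) ^ q / fact q * (real (q * N) ^ x / fact x *
          (real ((q + 2 * x) ^ 2) ^ (k * q) / fact (k * q)))) * (?W / real M ^ (x + k * q))"
        by (intro mult_right_mono card_configs) simp
      finally show "(\<Sum>c\<in>configs k q x. real (card (?ev c))) \<le>
          ?W * (real (2 * N) ^ q / fact q * (real (q * N) ^ x / fact x) *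
          (real ((q + 2 * x) ^ 2) ^ (k * q) / fact (k * q)) / real M ^ (x + k * q))"
        by (simp add: mult_ac)
    qed
    also have "\<dots> \<le> ?W * (1 / 4) ^ q"
      unfolding sum_distrib_left[symmetric] by (intro mult_left_mono bound q) simp
    finally show "(\<Sum>x\<le>8 * k * q. \<Sum>c\<in>configs k q x. real (card (?ev c))) \<le> ?W * (1 / 4) ^ q" .
  qed
  also have "\<dots> = ?W * ((1 - (1 / 4) ^ m) / 3)"
    unfolding sum_distrib_left[symmetric] sum_quarter_powers ..
  also have "\<dots> \<le> ?W * (1 / 3)" by (intro mult_left_mono) auto
  finally show False using M_pos by simp
qed

end

section \<open>Induced size Ramsey numbers of trees\<close>

lemma ind_size_ramsey_le:
  assumes "graph G" "induced_ramsey G T"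
  shows "ind_size_ramsey T \<le> enat (num_edges (G :: nat set \<times> nat set set))"
  unfolding ind_size_ramsey_def using assms by (intro INF_lower) simp

text \<open>With 32\<open>k\<close> edges per left vertex and equally many vertices on both sides,
  the density required by \<open>induced_ramsey_host\<close> holds with equality. Taking
  \<open>k\<close> = 5\<Delta> ensures both \<open>k\<close> at least 10 and \<Delta> at most
  2\<open>k\<close>.\<close>

theorem ind_size_ramsey_tree_le:
  fixes T :: "'a set \<times> 'a set set" and \<Delta> :: nat
  assumes T: "tree T" "max_degree_le T \<Delta>" and \<Delta>: "\<Delta> \<ge> 2"
  shows "ind_size_ramsey T \<le> enat (256 * 10 ^ 22 * \<Delta> ^ 3 * card (fst T))"
proof -
  define n where "n = card (fst T)"
  have n: "n > 0"
    using T unfolding n_def tree_def graph_def connected_graph_def by (simp add: card_gt_0_iff)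
  define k where "k = 5 * \<Delta>"
  define M where "M = 2 * 10 ^ 19 * k * n"
  define N where "N = 32 * k * M"
  have k: "k \<ge> 10" using \<Delta> k_def by simp
  have M: "M > 0" using M_def k n by simp
  interpret random_host M "32 * k" N
    by unfold_locales (use M N_def in auto)
  have "\<exists>g\<in>choices. locally_sparse (left \<union> right) (pairs g) (8 * k) k (2 * n + 1)"
  proof (rule exists_sparse)
    \<comment> \<open>Since \<open>n\<close> is positive, \<open>q\<close> is at most
      3\<open>n\<close>, as \<open>union_bound_term\<close> demands.\<close>
    fix q assume "q \<in> {1..2 * n + 1}"
    then show "(\<Sum>x\<le>8 * k * q. real (2 * N) ^ q / fact q * (real (q * N) ^ x / fact x) *
      (real ((q + 2 * x) ^ 2) ^ (k * q) / fact (k * q)) / real M ^ (x + k * q)) \<le> (1 / 4) ^ q"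
      using n k by (intro union_bound_term[OF _ _ _ M_def N_def]) auto
  qed
  then obtain g where g: "g \<in> choices"
    and sparse: "locally_sparse (left \<union> right) (pairs g) (8 * k) k (2 * n + 1)" by blast
  interpret G: bipartite left right "pairs g" by (rule pairs_bipartite[OF g])
  have V: "left \<union> right = {..<2 * N}" by auto
  have "max_degree_le T (2 * k)"
    using T(2) unfolding max_degree_le_def k_def by fastforce
  moreover have "16 * k * card (left \<union> right) \<le> card (pairs g)"
    unfolding V card_pairs[OF g] by simp
  moreover have "left \<union> right \<noteq> {}"
  proof -
    have "0 \<in> left" using N_def M k by simp
    then show ?thesis by blast
  qed
  ultimately have "induced_ramsey (host (left \<union> right) (pairs g)) T"
    using G.induced_ramsey_host[OF T(1)] sparse k n_def by simp
  then have "ind_size_ramsey T \<le> enat (num_edges (host (left \<union> right) (pairs g)))"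
    by (rule ind_size_ramsey_le[OF G.graph_host])
  also have "\<dots> \<le> enat (N * (32 * k))"
    using G.num_edges_host card_pairs[OF g] by simp
  also have "N * (32 * k) = 256 * 10 ^ 22 * \<Delta> ^ 3 * card (fst T)"
    unfolding N_def M_def k_def n_def by (simp add: power3_eq_cube)
  finally show ?thesis .
qed

theorem theorem1p5:
  shows "(\<forall>\<Delta>::nat. \<exists>C::real. \<forall>T :: nat set \<times> nat set set.
            tree T \<and> max_degree_le T \<Delta> \<longrightarrow>
            (\<exists>m. ind_size_ramsey T = enat m \<and> real m < C * real (card (fst T))))
       \<and> (\<forall>\<Delta>::nat. \<Delta> \<ge> 2 \<longrightarrow> (\<forall>T :: nat set \<times> nat set set.
            tree T \<and> max_degree_le T \<Delta> \<longrightarrow>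
            (\<exists>m. ind_size_ramsey T = enat m \<and>
                 real m < 10^25 * real \<Delta>^3 * ln (real \<Delta>) * real (card (fst T)))))"
proof -
  have explicit: "\<exists>m. ind_size_ramsey T = enat m \<and>
      real m < 10^25 * real \<Delta>^3 * ln (real \<Delta>) * real (card (fst T))"
    if \<Delta>: "\<Delta> \<ge> 2" and T: "tree T" "max_degree_le T \<Delta>" for \<Delta> and T :: "nat set \<times> nat set set"
  proof -
    obtain m where m: "ind_size_ramsey T = enat m" "m \<le> 256 * 10 ^ 22 * \<Delta> ^ 3 * card (fst T)"
      using ind_size_ramsey_tree_le[OF T \<Delta>] by (cases "ind_size_ramsey T") auto
    have pos: "card (fst T) > 0"
      using T unfolding tree_def graph_def connected_graph_def by (simp add: card_gt_0_iff)
    \<comment> \<open>The logarithm is at least 1/3 because e is at most 8; and 256 * 10^22 is below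
      10^25 / 3.\<close>
    have "1 \<le> ln ((2::real) ^ 3)" using exp_le by (subst ln_ge_iff) auto
    also have "\<dots> = 3 * ln 2" by (subst ln_realpow) auto
    finally have "1 / 3 \<le> ln (2::real)" by simp
    moreover have "ln 2 \<le> ln (real \<Delta>)" using \<Delta> by simp
    ultimately have "1 / 3 \<le> ln (real \<Delta>)" by linarith
    define X where "X = real \<Delta> ^ 3 * real (card (fst T))"
    define Y where "Y = X * ln (real \<Delta>)"
    have "X * (1 / 3) \<le> Y" unfolding Y_def
      using \<open>1 / 3 \<le> ln (real \<Delta>)\<close> by (intro mult_left_mono) (auto simp: X_def)
    moreover have "real m \<le> 256 * 10 ^ 22 * X"
      using of_nat_mono[OF m(2), where 'a = real] by (simp add: X_def)
    moreover have "X > 0" using pos \<Delta> by (simp add: X_def)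
    ultimately have "real m < 10^25 * Y" by simp
    then show ?thesis using m(1) by (simp add: X_def Y_def mult_ac)
  qed
  have "\<exists>C::real. \<forall>T :: nat set \<times> nat set set. tree T \<and> max_degree_le T \<Delta> \<longrightarrow>
      (\<exists>m. ind_size_ramsey T = enat m \<and> real m < C * real (card (fst T)))" for \<Delta>
  proof -
    \<comment> \<open>For \<Delta> below 2 the explicit bound does not apply, and its logarithmic
      factor would vanish; degree bound 2 covers these cases.\<close>
    have "max_degree_le T (max \<Delta> 2)" if "max_degree_le T \<Delta>" for T :: "nat set \<times> nat set set"
      using that unfolding max_degree_le_def by (auto simp: max.coboundedI1)
    then show ?thesis using explicit[of "max \<Delta> 2"] by (meson max.cobounded2)
  qed
  then show ?thesis using explicit by blast
qed

end
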